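(* Let $\mu$ be a probability distribution on $\mathbb N=\{1,2,\ldots\}$ such that $$\sum_{k\in\mathbb N}k\,\mu(k)<\infty\quad\text{and}\quad \sup_{k\in\mathbb N}\mu(k)<1.$$ Let $(\xi_n)_{n\in\mathbb Z}$ be i.i.d. random variables with law $\mu$ and let $\mathcal F_n:=\sigma(\xi_k,\,-\infty<k\le n)$. Then almost surely there exists a unique process $(Y_n)_{n\in\mathbb Z}$ with values in $\mathbb S_0$ satisfying $$Y_{n+1}=\Theta\big(\Phi_{\xi_{n+1}}(Y_n)\big),\qquad n\in\mathbb Z,$$ and such that $Y_n$ is $\mathcal F_n$-measurable for all $n\in\mathbb Z$.
   Context: A configuration is a map $X:\mathbb Z\to\{0,1,2,\ldots\}\cup\{\infty\}$ for which there is $f\in\mathbb Z$ such that $X(k)=0$ if and only if $k>f$; $\mathbb S$ is the set of configurations and $F(X):=\max\{k:X(k)>0\}$. $\mathbb S_0:=\{X\in\mathbb S:F(X)=0\}$. For $\xi\in\mathbb N$, $B(X,\xi):=\inf\{k\in\mathbb Z:\sum_{j>k}X(j)<\xi\}$ and $\Phi_\xi(X):=X+\delta_{B(X,\xi)+1}$, where $\delta_k$ is $1$ at $k$ and $0$ elsewhere. The map $\Theta:\mathbb S\to\mathbb S_0$ pins the front at $0$: $(\Theta X)(k):=X(k+F(X))$, $k\in\mathbb Z$. *)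

theory Defs
  imports "HOL-Probability.Probability"
begin

type_synonym config = "int \<Rightarrow> enat"

definition configs :: "config set" where
  "configs = {X. \<exists>f. \<forall>k. X k = 0 \<longleftrightarrow> k > f}"

(* Greatest rather than Max: the set of nonempty bins is infinite to the left. *)
definition front :: "config \<Rightarrow> int" where
  "front X = (GREATEST k. X k > 0)"

definition configs0 :: "config set" where
  "configs0 = {X \<in> configs. front X = 0}"

(* Only used for \<xi> \<ge> 1 and X \<in> configs, where the set is nonempty and bounded
   below (so that Inf on int is meaningful) and each sum has finitely many nonzero terms. *)
definition bin_pos :: "config \<Rightarrow> nat \<Rightarrow> int" where
  "bin_pos X \<xi> = Inf {k. (\<Sum>\<^sub>\<infinity>j\<in>{k<..}. X j) < enat \<xi>}"

definition Phi :: "nat \<Rightarrow> config \<Rightarrow> config" where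
  "Phi \<xi> X = (\<lambda>k. X k + of_bool (k = bin_pos X \<xi> + 1))"

definition Theta :: "config \<Rightarrow> config" where
  "Theta X = (\<lambda>k. X (k + front X))"

(* The product sigma-algebra of the discrete ones on the bins, restricted to configs0. *)
definition config0_space :: "config measure" where
  "config0_space = restrict_space (\<Pi>\<^sub>M k\<in>UNIV. count_space UNIV) configs0"

(* The sigma-algebra generated by the \<xi> k, k \<le> n; as a measure it is null. *)
definition past :: "'a measure \<Rightarrow> (int \<Rightarrow> 'a \<Rightarrow> nat) \<Rightarrow> int \<Rightarrow> 'a measure" where
  "past M \<xi> n = sigma (space M) {\<xi> k -` A \<inter> space M | k A. k \<le> n}"

(* A measurable map into config0_space takes all its values in configs0. *)
definition adapted_solution ::
    "'a measure \<Rightarrow> (int \<Rightarrow> 'a \<Rightarrow> nat) \<Rightarrow> (int \<Rightarrow> 'a \<Rightarrow> config) \<Rightarrow> bool" where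
  "adapted_solution M \<xi> Y \<longleftrightarrow>
     (\<forall>n. Y n \<in> measurable (past M \<xi> n) config0_space) \<and>
     (AE \<omega> in M. \<forall>n. Y (n + 1) \<omega> = Theta (Phi (\<xi> (n + 1) \<omega>) (Y n \<omega>)))"

end

theory Submission
  imports Defs
begin

text \<open>
  A configuration is encoded by its tail counts: the number of balls in the bins \<open>\<ge> k\<close>. If two
  configurations have the same top \<open>K\<close> balls, seen from the front, then a move of type \<open>\<xi> \<le> K\<close>
  makes their top \<open>K + 1\<close> balls agree. Two values \<open>a < b\<close> of positive probability
  suffice to write a word after which the top \<open>K\<close> balls do not depend on the initial configuration.
  If the \<open>j\<close>-th type after this word is at most \<open>K + j\<close> for every \<open>j \<ge> 0\<close>, then no information is
  ever lost; because the mean is finite this has positive probability for large \<open>K\<close>, and by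
  Kolmogorov's 0-1 law such renewals occur almost surely infinitely often in the past. Each
  occurrence of the word moves the front, hence starting earlier and earlier in the past fixes the
  contents of any given bin at time \<open>n\<close>, whatever the initial configuration. This gives uniqueness,
  and existence as a limit of the processes started at time \<open>n - m\<close>.
\<close>

section \<open>Tail counts\<close>

definition tail :: "config \<Rightarrow> int \<Rightarrow> enat" where
  "tail X k = (\<Sum>\<^sub>\<infinity>j\<in>{k..}. X j)"

definition move :: "nat \<Rightarrow> config \<Rightarrow> config" where
  "move \<xi> X = Theta (Phi \<xi> X)"

definition tails :: "(int \<Rightarrow> enat) set" where
  "tails = {T. (\<forall>k>0. T k = 0) \<and> (\<forall>k\<le>0. T (k + 1) + 1 \<le> T k)}"

text \<open>The action of a pinned move on tail counts. Here \<open>s\<close> is the displacement of the front; the new ball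
  lies one bin above the \<open>\<xi>\<close>-th ball, which is in a bin \<open>\<ge> j\<close> exactly when \<open>\<xi> \<le> T j\<close>.\<close>

definition tail_move :: "nat \<Rightarrow> (int \<Rightarrow> enat) \<Rightarrow> int \<Rightarrow> enat" where
  "tail_move \<xi> T k =
     (let s = of_bool (enat \<xi> \<le> T 0) in T (k + s) + of_bool (enat \<xi> \<le> T (k + s - 1)))"

lemma front_eqI:
  assumes "\<And>k. X k = 0 \<longleftrightarrow> k > f"
  shows "front X = f"
  unfolding front_def
proof (rule Greatest_equality)
  show "X f > 0"
    using assms[of f] by (simp add: zero_less_iff_neq_zero)
  show "k \<le> f" if "X k > 0" for k
    using assms[of k] that by (auto simp: not_less)
qed

lemma configs0_iff: "X \<in> configs0 \<longleftrightarrow> (\<forall>k. X k = 0 \<longleftrightarrow> k > 0)"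
proof
  assume "X \<in> configs0"
  then obtain f where f: "\<forall>k. X k = 0 \<longleftrightarrow> k > f" and "front X = 0"
    by (auto simp: configs0_def configs_def)
  then show "\<forall>k. X k = 0 \<longleftrightarrow> k > 0"
    using front_eqI[of X f] by simp
next
  assume "\<forall>k. X k = 0 \<longleftrightarrow> k > 0"
  then show "X \<in> configs0"
    using front_eqI[of X 0] by (auto simp: configs0_def configs_def)
qed

lemma tail_eq_sum:
  assumes "\<And>k. k > f \<Longrightarrow> X k = 0"
  shows "tail X k = (\<Sum>j\<in>{k..f}. X j)"
proof -
  have "tail X k = (\<Sum>\<^sub>\<infinity>j\<in>{k..f}. X j)"
    unfolding tail_def by (rule infsum_cong_neutral) (use assms in auto)
  then show ?thesis by simp
qed

lemma tail_rec:
  assumes "X \<in> configs0"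
  shows "tail X k = X k + tail X (k + 1)"
proof -
  have X: "X j = 0 \<longleftrightarrow> j > 0" for j using assms by (simp add: configs0_iff)
  have eq: "tail X k = (\<Sum>j\<in>{k..max 0 k}. X j)" for k
    by (rule tail_eq_sum) (use X in auto)
  have eq': "tail X (k + 1) = (\<Sum>j\<in>{k+1..max 0 k}. X j)" 
    by (rule tail_eq_sum) (use X in auto)
  have "{k..max 0 k} = insert k {k+1..max 0 k}" by auto
  then show ?thesis unfolding eq[of k] eq' by simp
qed

lemma tail_in_tails:
  assumes "X \<in> configs0"
  shows "tail X \<in> tails"
proof -
  have X: "X j = 0 \<longleftrightarrow> j > 0" for j using assms by (simp add: configs0_iff)
  have "tail X k = 0" if "k > 0" for k
    using tail_eq_sum[of 0 X k] X that by simp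
  moreover have "tail X (k + 1) + 1 \<le> tail X k" if "k \<le> 0" for k
  proof -
    have "1 \<le> X k" using X[of k] that by (simp add: ileI1 one_eSuc zero_less_iff_neq_zero)
    then show ?thesis
      unfolding tail_rec[OF assms, of k] by (metis add.commute add_left_mono)
  qed
  ultimately show ?thesis by (simp add: tails_def)
qed

lemma tails_zero: "T \<in> tails \<Longrightarrow> k > 0 \<Longrightarrow> T k = 0"
  by (simp add: tails_def)

lemma tails_Suc: "T \<in> tails \<Longrightarrow> k \<le> 0 \<Longrightarrow> T (k + 1) + 1 \<le> T k"
  by (simp add: tails_def)

lemma tails_antimono:
  assumes "T \<in> tails" "j \<le> k"
  shows "T k \<le> T j"
  using assms(2)
proof (induction rule: int_le_induct)
  case (step i)
  have "T i \<le> T (i - 1)"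
  proof (cases "i - 1 \<le> 0")
    case True
    from tails_Suc[OF assms(1) this] have "T i + 1 \<le> T (i - 1)" by simp
    then show ?thesis by (meson le_iff_add order_trans)
  qed (use assms in \<open>simp add: tails_def\<close>)
  with step show ?case by simp
qed simp

text \<open>Every bin from \<open>- i\<close> up to 0 contributes a ball. This bounds the depth of
  the \<xi>-th ball uniformly over all pinned configurations.\<close>

lemma tails_ge:
  assumes "T \<in> tails"
  shows "enat (Suc i) \<le> T (- int i)"
proof (induction i)
  case 0
  from tails_Suc[OF assms, of 0] assms show ?case
    by (simp add: tails_zero one_enat_def)
next
  case (Suc i)
  have "enat (Suc (Suc i)) = enat (Suc i) + 1" by (simp add: one_enat_def)
  also have "\<dots> \<le> T (- int i) + 1" using Suc by (rule add_right_mono)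
  also have "\<dots> \<le> T (- int (Suc i))"
    using tails_Suc[OF assms, of "- int (Suc i)"] by simp
  finally show ?case .
qed

text \<open>The set under the infimum is closed upwards, contains 0 and is bounded below, since the
  top \<open>\<xi> + 1\<close> bins hold more than \<xi> balls; so the infimum is attained. It is
  the bin of the \<xi>-th ball from the top.\<close>

lemma le_bin_pos_iff:
  assumes X: "X \<in> configs0" and "\<xi> \<ge> 1"
  shows "k \<le> bin_pos X \<xi> \<longleftrightarrow> enat \<xi> \<le> tail X k"
proof -
  let ?A = "{k. tail X (k + 1) < enat \<xi>}"
  note T = tail_in_tails[OF X]
  have pos: "bin_pos X \<xi> = Inf ?A"
  proof -
    have "{k<..} = {k + 1..}" for k :: int by auto
    then show ?thesis by (simp add: bin_pos_def tail_def)
  qed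
  have lb: "- int \<xi> \<le> k" if "k \<in> ?A" for k
  proof (rule ccontr)
    assume "\<not> - int \<xi> \<le> k"
    then have "k + 1 \<le> - int \<xi>" by simp
    from tails_antimono[OF T this] tails_ge[OF T, of \<xi>] that
    have "enat (Suc \<xi>) < enat \<xi>" by (metis le_less_trans mem_Collect_eq order_trans)
    then show False by simp
  qed
  have ne: "0 \<in> ?A" using T assms(2) by (simp add: tails_zero zero_enat_def)
  define n where "n = (LEAST n. int n - int \<xi> \<in> ?A)"
  have inA: "int n - int \<xi> \<in> ?A" unfolding n_def
    by (rule LeastI[of _ \<xi>]) (use ne in simp)
  have least: "int n - int \<xi> \<le> k" if "k \<in> ?A" for k
  proof -
    have "int (nat (k + int \<xi>)) - int \<xi> = k" using lb[OF that] by simp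
    then have "n \<le> nat (k + int \<xi>)" unfolding n_def using that by (intro Least_le) simp
    then show ?thesis using lb[OF that] by simp
  qed
  have B: "bin_pos X \<xi> = int n - int \<xi>"
    unfolding pos by (rule cInf_eq_minimum[OF inA least])
  show ?thesis
  proof
    assume "k \<le> bin_pos X \<xi>"
    then have "k - 1 \<notin> ?A" using least[of "k - 1"] B by auto
    then show "enat \<xi> \<le> tail X k" by simp
  next
    assume k: "enat \<xi> \<le> tail X k"
    show "k \<le> bin_pos X \<xi>"
    proof (rule ccontr)
      assume "\<not> k \<le> bin_pos X \<xi>"
      then have "bin_pos X \<xi> + 1 \<le> k" by simp
      from tails_antimono[OF T this] k inA B show False by auto
    qed
  qed
qed

lemma tail_Phi:
  assumes X: "X \<in> configs0" and "\<xi> \<ge> 1"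
  shows "tail (Phi \<xi> X) k = tail X k + of_bool (k \<le> bin_pos X \<xi> + 1)"
proof -
  define b where "b = bin_pos X \<xi> + 1"
  define f where "f = max 0 b"
  have X0: "X j = 0 \<longleftrightarrow> j > 0" for j using X by (simp add: configs0_iff)
  have "tail (Phi \<xi> X) k = (\<Sum>j\<in>{k..f}. Phi \<xi> X j)"
    by (rule tail_eq_sum) (use X0 in \<open>auto simp: Phi_def f_def b_def\<close>)
  also have "\<dots> = (\<Sum>j\<in>{k..f}. X j) + (\<Sum>j\<in>{k..f}. of_bool (j = b))"
    by (simp add: Phi_def b_def sum.distrib)
  also have "(\<Sum>j\<in>{k..f}. X j) = tail X k"
    by (rule tail_eq_sum[symmetric]) (use X0 in \<open>auto simp: f_def\<close>)
  also have "(\<Sum>j\<in>{k..f}. of_bool (j = b)) = (of_bool (k \<le> b) :: enat)"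
    by (simp add: of_bool_def f_def sum.delta)
  finally show ?thesis by (simp add: b_def)
qed

lemma bin_pos_le:
  assumes X: "X \<in> configs0" and "\<xi> \<ge> 1"
  shows "bin_pos X \<xi> \<le> 0"
  using le_bin_pos_iff[OF assms, of 1] tail_in_tails[OF X] assms(2)
  by (auto simp: tails_zero zero_enat_def)

text \<open>The new ball falls into an occupied bin unless the \<xi>-th ball lies in the front bin;
  then it opens bin 1.\<close>

lemma Phi_zero_iff:
  assumes X: "X \<in> configs0" and "\<xi> \<ge> 1"
  shows "Phi \<xi> X k = 0 \<longleftrightarrow> k > of_bool (enat \<xi> \<le> tail X 0)"
proof -
  have X0: "X j = 0 \<longleftrightarrow> j > 0" for j using X by (simp add: configs0_iff)
  show ?thesis
    using bin_pos_le[OF assms] le_bin_pos_iff[OF assms, of 0] X0[of k]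
    by (auto simp: Phi_def)
qed

lemma front_Phi:
  assumes "X \<in> configs0" "\<xi> \<ge> 1"
  shows "front (Phi \<xi> X) = of_bool (enat \<xi> \<le> tail X 0)"
  by (rule front_eqI) (rule Phi_zero_iff[OF assms])

lemma move_configs0:
  assumes "X \<in> configs0" "\<xi> \<ge> 1"
  shows "move \<xi> X \<in> configs0"
  unfolding move_def Theta_def configs0_iff front_Phi[OF assms] Phi_zero_iff[OF assms] by auto

lemma tail_shift: "tail (\<lambda>k. X (k + s)) k = tail X (k + s)"
  unfolding tail_def
  by (rule infsum_reindex_bij_witness[of _ "\<lambda>j. j - s" "\<lambda>j. j + s"]) auto

lemma tail_move:
  assumes "X \<in> configs0" "\<xi> \<ge> 1"
  shows "tail (move \<xi> X) = tail_move \<xi> (tail X)"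
proof
  fix k
  define s :: int where "s = of_bool (enat \<xi> \<le> tail X 0)"
  have "tail (move \<xi> X) k = tail (Phi \<xi> X) (k + s)"
    unfolding move_def Theta_def front_Phi[OF assms] tail_shift s_def ..
  also have "\<dots> = tail X (k + s) + of_bool (k + s - 1 \<le> bin_pos X \<xi>)"
    unfolding tail_Phi[OF assms] by (simp add: diff_le_eq)
  finally show "tail (move \<xi> X) k = tail_move \<xi> (tail X) k"
    unfolding le_bin_pos_iff[OF assms] tail_move_def Let_def s_def .
qed

section \<open>Coupling words\<close>

lemma tail_move_tails:
  assumes T: "T \<in> tails" and "\<xi> \<ge> 1"
  shows "tail_move \<xi> T \<in> tails"
proof -
  define s :: int where "s = of_bool (enat \<xi> \<le> T 0)"
  have M: "tail_move \<xi> T k = T (k + s) + of_bool (enat \<xi> \<le> T (k + s - 1))" for k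
    by (simp add: tail_move_def s_def Let_def)
  have "tail_move \<xi> T k = 0" if "k > 0" for k
  proof -
    have "\<not> enat \<xi> \<le> T (k + s - 1)"
      using that assms tails_antimono[OF T, of 0 "k + s - 1"] tails_zero[OF T, of "k + s - 1"]
      by (cases "enat \<xi> \<le> T 0") (auto simp: s_def zero_enat_def)
    moreover have "T (k + s) = 0" using that by (intro tails_zero[OF T]) (simp add: s_def)
    ultimately show ?thesis by (simp add: M)
  qed
  moreover have "tail_move \<xi> T (k + 1) + 1 \<le> tail_move \<xi> T k" if k: "k \<le> 0" for k
  proof (cases "k + s \<le> 0")
    case True
    have "of_bool (enat \<xi> \<le> T (k + s)) \<le> (of_bool (enat \<xi> \<le> T (k + s - 1)) :: enat)"
      using tails_antimono[OF T, of "k + s - 1" "k + s"] by (auto intro: order_trans)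
    from add_mono[OF tails_Suc[OF T True] this] show ?thesis
      by (simp add: M algebra_simps)
  next
    case False
    then have "enat \<xi> \<le> T 0" using k by (cases "enat \<xi> \<le> T 0") (auto simp: s_def)
    moreover from this False k have "k = 0" "s = 1" by (auto simp: s_def)
    ultimately show ?thesis using assms(2) tails_zero[OF T, of 1] tails_zero[OF T, of 2]
      by (simp add: M zero_enat_def)
  qed
  ultimately show ?thesis by (simp add: tails_def)
qed

text \<open>Truncation at \<open>K\<close> retains the bins of the top \<open>K\<close> balls and
  forgets everything deeper.\<close>

definition agree :: "nat \<Rightarrow> (int \<Rightarrow> enat) \<Rightarrow> (int \<Rightarrow> enat) \<Rightarrow> bool" where
  "agree K T T' \<longleftrightarrow> (\<forall>k. min (enat K) (T k) = min (enat K) (T' k))"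

lemma agree_sym: "agree K T T' \<Longrightarrow> agree K T' T"
  by (simp add: agree_def)

lemma agree_trans: "agree K T T' \<Longrightarrow> agree K T' T'' \<Longrightarrow> agree K T T''"
  by (simp add: agree_def)

lemma agree_mono: 
  assumes "agree K T T'" "L \<le> K"
  shows "agree L T T'"
proof -
  have "min (enat L) x = min (enat L) (min (enat K) x)" for x
    using assms(2) by (simp add: min.absorb1 flip: min.assoc)
  then show ?thesis using assms(1) unfolding agree_def by metis
qed

lemma agree_le_iff:
  assumes "agree K T T'" "c \<le> K"
  shows "enat c \<le> T k \<longleftrightarrow> enat c \<le> T' k"
proof -
  have "enat c \<le> x \<longleftrightarrow> enat c \<le> min (enat K) x" for x
    using assms(2) by simp
  then show ?thesis using assms(1) unfolding agree_def by metis
qed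

lemma agree_eq:
  assumes "agree K T T'" "T k < enat K"
  shows "T' k = T k"
proof -
  have "min (enat K) (T' k) = min (enat K) (T k)" using assms(1) by (simp add: agree_def)
  also have "\<dots> = T k" using assms(2) by simp
  finally have "min (enat K) (T' k) = T k" .
  with assms(2) show ?thesis by (simp add: min_def split: if_splits)
qed

text \<open>The top \<open>K\<close> balls decide both the displacement and the bin of the new ball.
  Where the new ball is counted, both truncated counts grow by one; elsewhere the count is below
  \<xi>, hence below \<open>K\<close>, and agreement is equality.\<close>

lemma agree_tail_move:
  assumes A: "agree K T T'" and T: "T \<in> tails" and "\<xi> \<le> K"
  shows "agree (Suc K) (tail_move \<xi> T) (tail_move \<xi> T')"
  unfolding agree_def
proof
  fix k
  define s :: int where "s = of_bool (enat \<xi> \<le> T 0)"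
  have s': "s = of_bool (enat \<xi> \<le> T' 0)"
    using agree_le_iff[OF A \<open>\<xi> \<le> K\<close>] by (simp add: s_def)
  have M: "tail_move \<xi> T k = T (k + s) + of_bool (enat \<xi> \<le> T (k + s - 1))"
    by (simp add: tail_move_def s_def Let_def)
  have M': "tail_move \<xi> T' k = T' (k + s) + of_bool (enat \<xi> \<le> T (k + s - 1))"
    using agree_le_iff[OF A \<open>\<xi> \<le> K\<close>] by (simp add: tail_move_def s' Let_def)
  show "min (enat (Suc K)) (tail_move \<xi> T k) = min (enat (Suc K)) (tail_move \<xi> T' k)"
  proof (cases "enat \<xi> \<le> T (k + s - 1)")
    case True
    have eq: "min (enat (Suc K)) (x + 1) = min (enat K) x + 1" for x
      by (cases x) (auto simp: one_enat_def)
    show ?thesis using True A by (simp add: M M' eq agree_def)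
  next
    case False
    have "T (k + s) \<le> T (k + s - 1)" by (rule tails_antimono[OF T]) simp
    also have "\<dots> < enat K" using False assms(3) by (meson enat_ord_simps(1) not_le order_less_le_trans)
    finally show ?thesis using False agree_eq[OF A, of "k + s"] by (simp add: M M')
  qed
qed

section \<open>Runs of moves of a single type\<close>

abbreviation run :: "nat list \<Rightarrow> (int \<Rightarrow> enat) \<Rightarrow> int \<Rightarrow> enat" where
  "run \<equiv> fold tail_move"

lemma run_tails: "T \<in> tails \<Longrightarrow> \<forall>w\<in>set ws. w \<ge> 1 \<Longrightarrow> run ws T \<in> tails"
  by (induction ws arbitrary: T) (simp_all add: tail_move_tails)

lemma agree_run:
  assumes "agree K T T'" "T \<in> tails" "\<forall>w\<in>set ws. 1 \<le> w \<and> w \<le> K"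
  shows "agree (K + length ws) (run ws T) (run ws T')"
  using assms
proof (induction ws arbitrary: K T T')
  case (Cons w ws)
  have "agree (Suc K) (tail_move w T) (tail_move w T')"
    using Cons.prems by (intro agree_tail_move) auto
  moreover have "tail_move w T \<in> tails" using Cons.prems by (intro tail_move_tails) auto
  ultimately show ?case using Cons.IH[of "Suc K" "tail_move w T" "tail_move w T'"] Cons.prems(3)
    by (auto simp: le_SucI)
qed simp

text \<open>Repeated moves of type \<open>c\<close> fill the bins one after the other with \<open>c\<close> balls each. The phase \<open>r\<close> of
  this cycle says that \<open>r + 1\<close> balls are in the front bin, so that \<open>r < c\<close> in all uses.\<close>

definition ideal :: "nat \<Rightarrow> nat \<Rightarrow> int \<Rightarrow> enat" where
  "ideal c r k = (if k > 0 then 0 else enat (Suc r + c * nat (- k)))"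

text \<open>If the front bin is short of \<open>c\<close> balls, the \<open>c\<close>-th ball lies
  in the bin below and the new one joins the front; if it is full, a new front bin with one ball
  opens and the phase returns to 0.\<close>

lemma tail_move_ideal:
  assumes "r < c"
  shows "tail_move c (ideal c r) = ideal c (Suc r mod c)"
proof
  fix k :: int
  show "tail_move c (ideal c r) k = ideal c (Suc r mod c) k"
  proof (cases "Suc r = c")
    case True
    then have move: "tail_move c (ideal c r) k = ideal c r (k + 1) + of_bool (enat c \<le> ideal c r k)"
      by (simp add: tail_move_def ideal_def)
    have "k = - int (Suc (nat (- k - 1)))" if "k < 0" using that by simp
    then consider "k > 0" | "k = 0" | n where "k = - int (Suc n)"
      by (meson linorder_neqE_linordered_idom)
    then show ?thesis
    proof cases
      case 3
      then have "nat (- k) = Suc n" "nat (- (k + 1)) = n" "\<not> k > 0" "\<not> k + 1 > 0" by auto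
      then show ?thesis unfolding move using True by (simp add: ideal_def one_enat_def)
    qed (use True move in \<open>simp_all add: ideal_def one_enat_def zero_enat_def\<close>)
  next
    case False
    then have r: "Suc r mod c = Suc r" "\<not> c \<le> Suc r" using assms by auto
    show ?thesis
    proof (cases "k > 0")
      case True
      then show ?thesis using r by (cases "k = 1") (auto simp: tail_move_def ideal_def zero_enat_def)
    next
      case k: False
      have "nat (1 - k) = Suc (nat (- k))" using k by simp
      then have "c \<le> Suc r + c * nat (1 - k)" by simp
      then show ?thesis using r k by (simp add: tail_move_def ideal_def one_enat_def)
    qed
  qed
qed

lemma run_ideal:
  assumes "r < c"
  shows "run (replicate m c) (ideal c r) = ideal c ((r + m) mod c)"
  using assms
proof (induction m arbitrary: r)
  case (Suc m)
  then have "run (replicate (Suc m) c) (ideal c r) = run (replicate m c) (ideal c (Suc r mod c))"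
    by (simp add: tail_move_ideal)
  also have "\<dots> = ideal c ((Suc r mod c + m) mod c)" using Suc.prems by (intro Suc.IH) auto
  also have "(Suc r mod c + m) mod c = (r + Suc m) mod c" by (simp add: mod_add_left_eq)
  finally show ?case .
qed simp

text \<open>The number of moves of type \<open>c\<close> after which the front bin first has at least \<open>c\<close> balls.\<close>

definition deficit :: "nat \<Rightarrow> (int \<Rightarrow> enat) \<Rightarrow> nat" where
  "deficit c T = (\<Sum>i<c. c - the_enat (min (enat c) (T (- int i))))"

lemma deficit_le: "deficit c T \<le> c * c"
  unfolding deficit_def using sum_bounded_above[of "{..<c}" _ c] by simp

lemma deficit_cong: "agree c T T' \<Longrightarrow> deficit c T = deficit c T'"
  by (simp add: deficit_def agree_def)

lemma deficit_ideal: "deficit b (ideal a r) = (\<Sum>i<b. b - min b (Suc r + a * i))"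
  by (simp add: deficit_def ideal_def)

text \<open>A move adds a unit to the truncated counts exactly at those bins where the count is
  short of \<open>c\<close> while the next lower one is not. These increments telescope to the
  difference of the indicators at depths \<open>c\<close> and 0, which is 1.\<close>

lemma deficit_tail_move:
  assumes T: "T \<in> tails" and "c \<ge> 1" and lt: "T 0 < enat c"
  shows "deficit c T = Suc (deficit c (tail_move c T))"
proof -
  define f where "f i = int (the_enat (min (enat c) (T (- int i))))" for i
  define g where "g i = int (the_enat (min (enat c) (tail_move c T (- int i))))" for i
  define h :: "nat \<Rightarrow> int" where "h i = of_bool (enat c \<le> T (- int i))" for i
  have g: "g i = f i + (h (Suc i) - h i)" for i
  proof -
    have mv: "tail_move c T (- int i) = T (- int i) + of_bool (enat c \<le> T (- int (Suc i)))"
      using lt by (auto simp: tail_move_def algebra_simps not_le)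
    have mono: "T (- int i) \<le> T (- int (Suc i))" by (rule tails_antimono[OF T]) simp
    show ?thesis
    proof (cases "enat c \<le> T (- int i)")
      case True
      then have "enat c \<le> T (- int (Suc i))" using mono by (rule order_trans)
      moreover from True have "enat c \<le> T (- int i) + 1" by (metis le_iff_add order_trans)
      ultimately show ?thesis using True mv by (simp add: f_def g_def h_def)
    next
      case False
      then obtain t where t: "T (- int i) = enat t" "t < c"
        by (cases "T (- int i)") auto
      show ?thesis using False mv t by (simp add: f_def g_def h_def one_enat_def)
    qed
  qed
  have le: "the_enat (min (enat c) x) \<le> c" for x
    by (cases x) auto
  have d: "int (deficit c T') = (\<Sum>i<c. int c - int (the_enat (min (enat c) (T' (- int i)))))" for T'
    unfolding deficit_def of_nat_sum using le by (intro sum.cong) (auto simp: of_nat_diff)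
  have "int (deficit c T) - int (deficit c (tail_move c T)) = (\<Sum>i<c. g i - f i)"
    unfolding d by (simp add: f_def g_def sum_subtractf)
  also have "\<dots> = (\<Sum>i<c. h (Suc i) - h i)" by (simp add: g)
  also have "\<dots> = h c - h 0" by (rule sum_lessThan_telescope)
  also have "h c = 1"
  proof -
    have "enat c \<le> enat (Suc c)" by simp
    also note tails_ge[OF T, of c]
    finally show ?thesis by (simp add: h_def)
  qed
  also have "h 0 = 0" using lt by (simp add: h_def)
  finally show ?thesis by linarith
qed

lemma deficit_zero:
  assumes T: "T \<in> tails" and "c \<ge> 1" and "deficit c T = 0"
  shows "enat c \<le> T 0"
proof -
  from assms(3) have "\<forall>i\<in>{..<c}. c - the_enat (min (enat c) (T (- int i))) = 0"
    by (simp add: deficit_def)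
  then have "c - the_enat (min (enat c) (T (- int 0))) = 0"
    using \<open>c \<ge> 1\<close> by (intro bspec[where x = 0]) auto
  then show ?thesis by (cases "T 0") auto
qed

lemma deficit_pos:
  assumes T: "T \<in> tails" and "enat c \<le> T 0"
  shows "deficit c T = 0"
proof -
  have "enat c \<le> T (- int i)" for i
    using assms(2) tails_antimono[OF T, of "- int i" 0] by (auto intro: order_trans)
  then show ?thesis by (simp add: deficit_def)
qed

lemma agree_ideal_of_le:
  assumes T: "T \<in> tails" and "c \<ge> 1" and "enat c \<le> T 0"
  shows "agree c T (ideal c (c - 1))"
  unfolding agree_def
proof
  fix k :: int
  show "min (enat c) (T k) = min (enat c) (ideal c (c - 1) k)"
  proof (cases "k > 0")
    case False
    then have "enat c \<le> T k" using assms tails_antimono[OF T, of k 0] by (auto intro: order_trans)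
    moreover have "enat c \<le> ideal c (c - 1) k" using False \<open>c \<ge> 1\<close> by (simp add: ideal_def)
    ultimately show ?thesis by simp
  qed (simp add: ideal_def tails_zero[OF T])
qed

text \<open>Once the front bin holds \<open>c\<close> balls, it contains the whole top
  \<open>c\<close>, as it does in the last phase of the cycle.\<close>

lemma run_deficit:
  assumes "T \<in> tails" "c \<ge> 1"
  shows "agree c (run (replicate (deficit c T) c) T) (ideal c (c - 1))"
  using assms
proof (induction "deficit c T" arbitrary: T)
  case 0
  then show ?case using agree_ideal_of_le deficit_zero by simp
next
  case (Suc d)
  have lt: "T 0 < enat c" using deficit_pos[OF Suc.prems(1), of c] Suc.hyps(2) by force
  have "d = deficit c (tail_move c T)" using deficit_tail_move[OF Suc.prems lt] Suc.hyps(2) by simp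
  with Suc.hyps(1)[OF this tail_move_tails] Suc.prems Suc.hyps(2)[symmetric] show ?case by simp
qed

text \<open>After the first \<open>deficit c T\<close> moves the top \<open>c\<close> balls only run
  through the cycle, so the initial state survives in them as a residue modulo
  \<open>c\<close>.\<close>

lemma run_replicate:
  assumes "T \<in> tails" "c \<ge> 1" "deficit c T \<le> m"
  shows "agree c (run (replicate m c) T) (ideal c ((c - 1 + (m - deficit c T)) mod c))"
proof -
  let ?d = "deficit c T"
  have m: "replicate m c = replicate ?d c @ replicate (m - ?d) c"
    using assms(3) by (simp flip: replicate_add)
  have "agree (c + length (replicate (m - ?d) c))
     (run (replicate (m - ?d) c) (run (replicate ?d c) T))
     (run (replicate (m - ?d) c) (ideal c (c - 1)))"
  proof (rule agree_run)
    show "run (replicate ?d c) T \<in> tails" by (rule run_tails) (use assms in auto)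
  qed (use assms run_deficit in auto)
  then have "agree (c + (m - ?d)) (run (replicate m c) T) (ideal c ((c - 1 + (m - ?d)) mod c))"
    using assms(2) unfolding m fold_append comp_apply by (subst (asm) run_ideal) auto
  then show ?thesis by (rule agree_mono) simp
qed

text \<open>The deficit strictly decreases in the phase, and phase \<open>a\<close> is phase 0 seen
  one bin lower, so the total drop from 0 to \<open>a\<close> is \<open>b - 1\<close>. Hence the
  drop from \<open>r\<close> to \<open>a - 1\<close> is at most \<open>b - 2 - r\<close>, the margin
  that makes phases grow in \<open>merge_block\<close>.\<close>

lemma deficit_ideal_diff:
  assumes "1 \<le> a" "a < b" "r < a"
  shows "deficit b (ideal a r) + r + 2 \<le> deficit b (ideal a (a - 1)) + b"
proof -
  define e where "e r = (\<Sum>i<b. b - min b (Suc r + a * i))" for r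
  have e_Suc: "e (Suc r) + 1 \<le> e r" if "Suc r < b" for r
  proof -
    have "e (Suc r) < e r" unfolding e_def
      by (rule sum_strict_mono_ex1) (use that in \<open>auto intro!: bexI[of _ 0]\<close>)
    then show ?thesis by simp
  qed
  have e_add: "e r + r \<le> e 0" if "r < b" for r
    using that
  proof (induction r)
    case (Suc r)
    then show ?case using e_Suc[of r] by simp
  qed simp
  have "e 0 = (\<Sum>i<Suc b. b - min b (Suc 0 + a * i))"
  proof -
    have "min b (Suc 0 + a * b) = b" using mult_le_mono1[OF \<open>1 \<le> a\<close>, of b] by linarith
    then show ?thesis by (simp add: e_def)
  qed
  also have "\<dots> = (b - 1) + (\<Sum>i<b. b - min b (Suc 0 + a * Suc i))"
    unfolding sum.lessThan_Suc_shift using assms by simp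
  also have "(\<Sum>i<b. b - min b (Suc 0 + a * Suc i)) = e a"
    by (simp add: e_def algebra_simps)
  finally have "e 0 = b - 1 + e a" .
  moreover have "e a + 1 \<le> e (a - 1)" using e_Suc[of "a - 1"] assms by simp
  moreover have "e r + r \<le> e 0" using e_add assms by simp
  ultimately show ?thesis using assms unfolding deficit_ideal e_def[symmetric] by simp
qed

lemma agree_ideal_ideal:
  assumes "1 \<le> a" "a < b"
  shows "agree a (ideal b v) (ideal a (min v (a - 1)))"
  unfolding agree_def
proof
  fix k :: int
  have "min a (Suc (x + b * n)) = a" "min a (Suc (x + a * n)) = a" if "n > 0" for x n
  proof -
    have "a \<le> b * n" "a \<le> a * n" using mult_le_mono[of a b 1 n] that assms by auto
    then show "min a (Suc (x + b * n)) = a" "min a (Suc (x + a * n)) = a" by linarith+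
  qed
  then show "min (enat a) (ideal b v k) = min (enat a) (ideal a (min v (a - 1)) k)"
    using assms by (cases "k > 0"; cases "k = 0") (auto simp: ideal_def)
qed

text \<open>The number of \<open>b\<close>-moves is congruent modulo \<open>b\<close> to the deficit of the last phase \<open>a - 1\<close>. Hence this
  phase is followed by the last phase of the \<open>b\<close>-cycle, and the earlier ones by phases that have grown
  by at least one. Passing from a \<open>b\<close>-phase \<open>v\<close> to the \<open>a\<close>-phase truncates it to \<open>min v (a - 1)\<close>, which
  merges phases. The block of \<open>a\<close>-moves has a length divisible by \<open>a\<close> and only makes more balls known.\<close>

definition merge_block :: "nat \<Rightarrow> nat \<Rightarrow> nat list" where
  "merge_block a b =
     replicate (deficit b (ideal a (a - 1)) + b * b) b @ replicate (a * b) a"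

lemma merge_block:
  assumes "1 \<le> a" "a < b" "r < a" "T \<in> tails" and A: "agree b T (ideal a r)"
  shows "\<exists>r'<a. min (Suc r) (a - 1) \<le> r' \<and> agree b (run (merge_block a b) T) (ideal a r')"
proof -
  let ?d = "deficit b (ideal a r)" and ?d' = "deficit b (ideal a (a - 1))"
  define m where "m = ?d' + b * b"
  have d: "deficit b T = ?d" by (rule deficit_cong[OF A])
  have dm: "?d \<le> m" using deficit_le[of b "ideal a r"] by (simp add: m_def)
  define v where "v = (b - 1 + (m - ?d)) mod b"
  have v: "Suc r \<le> v"
  proof -
    have diff: "?d + r + 2 \<le> ?d' + b" using deficit_ideal_diff assms by simp
    have ge: "?d' \<le> ?d"
    proof -
      have "(\<Sum>i<b. b - min b (Suc (a - 1) + a * i)) \<le> (\<Sum>i<b. b - min b (Suc r + a * i))"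
        using assms by (intro sum_mono) auto
      then show ?thesis by (simp only: deficit_ideal)
    qed
    \<comment> \<open>The summand \<open>b * b\<close> makes \<open>m\<close> at least every deficit
      and disappears modulo \<open>b\<close>; what remains is below \<open>b\<close>.\<close>
    have "b - 1 + (m - ?d) = (b - 1 - (?d - ?d')) + b * b"
      using diff ge dm by (simp add: m_def)
    then have "v = (b - 1 - (?d - ?d')) mod b" by (simp add: v_def)
    also have "\<dots> = b - 1 - (?d - ?d')" using assms by simp
    finally show ?thesis using diff ge by simp
  qed
  have "agree b (run (replicate m b) T) (ideal b v)"
    unfolding v_def d[symmetric]
    by (rule run_replicate) (use assms(1,2,4) dm d in linarith)+
  then have "agree a (run (replicate m b) T) (ideal b v)"
    by (rule agree_mono) (use assms(2) in simp)
  then have "agree a (run (replicate m b) T) (ideal a (min v (a - 1)))"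
    using agree_ideal_ideal[OF assms(1,2)] by (rule agree_trans)
  then have "agree (a + length (replicate (a * b) a))
     (run (replicate (a * b) a) (run (replicate m b) T))
     (run (replicate (a * b) a) (ideal a (min v (a - 1))))"
  proof (rule agree_run)
    show "run (replicate m b) T \<in> tails" by (rule run_tails) (use assms(1,2,4) in auto)
  qed (use assms(1) in auto)
  then have "agree (a + a * b) (run (merge_block a b) T) (ideal a (min v (a - 1)))"
    using assms(1) unfolding merge_block_def m_def fold_append comp_apply
    by (subst (asm) run_ideal) auto
  moreover have "b \<le> a + a * b" using assms by (simp add: trans_le_add2)
  ultimately have "agree b (run (merge_block a b) T) (ideal a (min v (a - 1)))"
    by (rule agree_mono)
  then show ?thesis using v assms by (intro exI[of _ "min v (a - 1)"]) auto
qed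

text \<open>The phase grows with every block until it sticks at \<open>a - 1\<close>, so
  \<open>a\<close> blocks bring all phases together.\<close>

lemma run_merge_blocks:
  assumes "1 \<le> a" "a < b" "r < a" "T \<in> tails" "agree b T (ideal a r)"
  shows "\<exists>r'<a. min (r + j) (a - 1) \<le> r' \<and>
    agree b (run (concat (replicate j (merge_block a b))) T) (ideal a r')"
  using assms
proof (induction j arbitrary: r T)
  case 0
  then show ?case by (intro exI[of _ r]) simp
next
  case (Suc j)
  obtain r' where r': "r' < a" "min (Suc r) (a - 1) \<le> r'"
      "agree b (run (merge_block a b) T) (ideal a r')"
    using merge_block[OF Suc.prems] by blast
  have "run (merge_block a b) T \<in> tails"
    using Suc.prems by (intro run_tails) (auto simp: merge_block_def)
  from Suc.IH[OF Suc.prems(1,2) r'(1) this r'(3)] obtain r'' where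
    "r'' < a" "min (r' + j) (a - 1) \<le> r''"
    "agree b (run (concat (replicate (Suc j) (merge_block a b))) T) (ideal a r'')"
    by auto
  then show ?case using r' by (intro exI[of _ r'']) auto
qed

section \<open>Displacement of the front and the coupling word\<close>

primrec advances :: "nat list \<Rightarrow> (int \<Rightarrow> enat) \<Rightarrow> nat" where
  "advances [] T = 0"
| "advances (w # ws) T = of_bool (enat w \<le> T 0) + advances ws (tail_move w T)"

lemma advances_append: "advances (us @ vs) T = advances us T + advances vs (run us T)"
  by (induction us arbitrary: T) auto

text \<open>\<open>U\<close> locks the state to the \<open>a\<close>-cycle: its \<open>a * a\<close>
  moves cover every deficit and its \<open>a * b\<close> moves give agreement up to
  \<open>b\<close>. \<open>V\<close> merges the phases, and \<open>R\<close> extends the agreement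
  past \<open>K\<close> over whole cycles. The last \<open>a\<close> opens a new bin, so the front
  moves.\<close>

lemma coupling_word:
  assumes a: "1 \<le> a" and ab: "a < b"
  shows "\<exists>W. set W \<subseteq> {a, b} \<and>
           (\<forall>T\<in>tails. agree K (run W T) (ideal a 0) \<and> 1 \<le> advances W T)"
proof -
  define U where "U = replicate (a * a) a @ replicate (a * b) a"
  define V where "V = concat (replicate a (merge_block a b))"
  define R where "R = replicate (a * K) a"
  have set: "set (U @ V @ R @ [a]) \<subseteq> {a, b}"
    by (auto simp: U_def V_def R_def merge_block_def)
  have tails: "run ws T \<in> tails" if "T \<in> tails" "set ws \<subseteq> {a, b}" for ws T
    using that a ab by (intro run_tails) auto
  have "agree K (run (U @ V @ R @ [a]) T) (ideal a 0) \<and> 1 \<le> advances (U @ V @ R @ [a]) T"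
    if T: "T \<in> tails" for T
  proof -
    obtain r where r: "r < a" "agree a (run (replicate (a * a) a) T) (ideal a r)"
      using run_replicate[OF T a deficit_le] a by (meson mod_less_divisor less_le_trans zero_less_one)
    have "agree (a + length (replicate (a * b) a)) (run (replicate (a * b) a) (run (replicate (a * a) a) T))
      (run (replicate (a * b) a) (ideal a r))"
      using r(2) by (rule agree_run) (use a in \<open>auto intro!: tails[OF T] simp del: fold_replicate\<close>)
    then have "agree (a + a * b) (run U T) (ideal a r)"
      using r(1) unfolding U_def fold_append comp_apply by (subst (asm) run_ideal) auto
    moreover have "b \<le> a + a * b" using a by (simp add: trans_le_add2)
    ultimately have "agree b (run U T) (ideal a r)" by (rule agree_mono)
    moreover have TU: "run U T \<in> tails" using set by (intro tails[OF T]) auto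
    ultimately obtain r' where r': "r' < a" "min (r + a) (a - 1) \<le> r'"
      "agree b (run V (run U T)) (ideal a r')"
      using run_merge_blocks[OF a ab r(1), of "run U T" a] unfolding V_def by blast
    then have "r' = a - 1" by linarith
    with r' have A: "agree b (run V (run U T)) (ideal a (a - 1))" by simp
    have TV: "run V (run U T) \<in> tails" using set by (intro tails[OF TU]) auto
    have "agree (b + length R) (run R (run V (run U T))) (run R (ideal a (a - 1)))"
      using A TV by (rule agree_run) (use a ab in \<open>auto simp: R_def\<close>)
    moreover have "run R (ideal a (a - 1)) = ideal a ((a - 1 + a * K) mod a)"
      unfolding R_def by (rule run_ideal) (use a in simp)
    moreover have "(a - 1 + a * K) mod a = a - 1"
      unfolding mod_mult_self2 using a by simp
    ultimately have A': "agree (b + a * K) (run R (run V (run U T))) (ideal a (a - 1))"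
      by (simp add: R_def del: fold_replicate)
    have TR: "run R (run V (run U T)) \<in> tails" using set by (intro tails[OF TV]) auto
    have "agree (Suc (b + a * K)) (tail_move a (run R (run V (run U T)))) (tail_move a (ideal a (a - 1)))"
      by (rule agree_tail_move[OF A' TR]) (use ab in simp)
    moreover have "tail_move a (ideal a (a - 1)) = ideal a 0"
      using tail_move_ideal[of "a - 1" a] a by simp
    moreover have "K \<le> Suc (b + a * K)" using mult_le_mono1[OF a, of K] by linarith
    ultimately have "agree K (run (U @ V @ R @ [a]) T) (ideal a 0)"
      by (simp add: agree_mono)
    moreover have "enat a \<le> run R (run V (run U T)) 0"
      using agree_le_iff[OF A', of a 0] ab a by (simp add: ideal_def)
    then have "1 \<le> advances (U @ V @ R @ [a]) T" by (simp add: advances_append)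
    ultimately show ?thesis ..
  qed
  with set show ?thesis by blast
qed

text \<open>A count below \<open>K\<close> at depth \<open>h\<close> says that the top
  \<open>K\<close> balls reach below bin \<open>- h\<close>. One move raises the number of known
  balls by one and a count by at most one, and shifts depths by the displacement, so the strict
  bound persists; the bound \<open>K + j\<close> on the types grows in step.\<close>

lemma agree_run_advances:
  assumes "agree K T T'" "T (- int h) < enat K" "T \<in> tails"
    and "\<forall>j<length ws. 1 \<le> ws ! j \<and> ws ! j \<le> K + j"
  shows "agree (K + length ws) (run ws T) (run ws T') \<and>
         run ws T (- int (h + advances ws T)) < enat (K + length ws)"
  using assms
proof (induction ws arbitrary: K T T' h)
  case (Cons w ws)
  have w: "1 \<le> w" "w \<le> K" using Cons.prems(4)[rule_format, of 0] by auto
  let ?s = "of_bool (enat w \<le> T 0) :: nat"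
  have "T (- int h) + of_bool (enat w \<le> T (- int h - 1)) \<le> T (- int h) + 1"
    by (intro add_left_mono) simp
  also have "\<dots> < enat (Suc K)" using Cons.prems(2) by (cases "T (- int h)") (auto simp: one_enat_def)
  finally have "tail_move w T (- int (h + ?s)) < enat (Suc K)"
    by (simp add: tail_move_def split: if_splits)
  moreover have "agree (Suc K) (tail_move w T) (tail_move w T')"
    using Cons.prems w by (intro agree_tail_move) auto
  moreover have "tail_move w T \<in> tails" using Cons.prems w by (intro tail_move_tails) auto
  moreover have "\<forall>j<length ws. 1 \<le> ws ! j \<and> ws ! j \<le> Suc K + j"
  proof (intro allI impI)
    fix j assume "j < length ws"
    then show "1 \<le> ws ! j \<and> ws ! j \<le> Suc K + j"
      using Cons.prems(4)[rule_format, of "Suc j"] by simp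
  qed
  ultimately have "agree (Suc K + length ws) (run ws (tail_move w T)) (run ws (tail_move w T')) \<and>
     run ws (tail_move w T) (- int (h + ?s + advances ws (tail_move w T))) < enat (Suc K + length ws)"
    by (intro Cons.IH)
  then show ?case by (simp add: add.assoc)
qed simp

text \<open>One set for each position makes a renewal a product event, whose probability factorises
  under independence.\<close>

definition allowed :: "nat list \<Rightarrow> nat \<Rightarrow> nat \<Rightarrow> nat set" where
  "allowed W K j = (if j < length W then {W ! j} else {..K + (j - length W)})"

text \<open>The deterministic half of the argument: everything random enters through
  \<open>often\<close>, where \<open>- m\<close> is the starting time of a renewal.\<close>

locale renewal =
  fixes W :: "nat list" and K a :: nat and x :: "int \<Rightarrow> nat" and n :: int
  assumes K: "2 \<le> K"
    and pos: "\<And>k. 1 \<le> x k"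
    and coupling: "\<And>T. T \<in> tails \<Longrightarrow> agree K (run W T) (ideal a 0)"
    and advances: "\<And>T. T \<in> tails \<Longrightarrow> 1 \<le> advances W T"
    and often: "\<And>N. \<exists>m\<ge>N. \<forall>j. int j \<le> int m + n \<longrightarrow> x (int j - int m) \<in> allowed W K j"
begin

lemma run_in_tails: "T \<in> tails \<Longrightarrow> run (map x ks) T \<in> tails"
  using pos by (intro run_tails) auto

lemma renewal_before:
  obtains m where "- int m + int (length W) < i"
    and "\<And>j. int j \<le> int m + n \<Longrightarrow> x (int j - int m) \<in> allowed W K j"
proof -
  from often[of "nat (int (length W) - i + 1)"] obtain m where
    "m \<ge> nat (int (length W) - i + 1)" "\<forall>j. int j \<le> int m + n \<longrightarrow> x (int j - int m) \<in> allowed W K j"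
    by blast
  then show thesis by (intro that[of m]) auto
qed

lemma map_upto_split:
  assumes m: "- int m + int (length W) < i" and i: "i \<le> n + 1"
    and C: "\<And>j. int j \<le> int m + n \<Longrightarrow> x (int j - int m) \<in> allowed W K j"
  shows "map x [- int m..n] = W @ map x [int (length W) - int m..i - 1] @ map x [i..n]"
proof -
  have "[- int m..n] = [- int m..int (length W) - int m - 1] @ [int (length W) - int m..n]"
    by (rule upto_split1) (use m i in auto)
  also have "[int (length W) - int m..n] = [int (length W) - int m..i - 1] @ [i - 1 + 1..n]"
    by (rule upto_split2) (use m i in auto)
  finally have "map x [- int m..n] = map x [- int m..int (length W) - int m - 1] @
     map x [int (length W) - int m..i - 1] @ map x [i..n]" by simp
  moreover have "map x [- int m..int (length W) - int m - 1] = W"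
  proof (rule nth_equalityI)
    show "length (map x [- int m..int (length W) - int m - 1]) = length W" by simp
    fix j assume "j < length (map x [- int m..int (length W) - int m - 1])"
    then have j: "j < length W" by simp
    then show "map x [- int m..int (length W) - int m - 1] ! j = W ! j"
      using C[of j] m i by (simp add: allowed_def nth_upto)
  qed
  ultimately show ?thesis by simp
qed

text \<open>The word of a renewal placed before \<open>i\<close> moves the front once more, whatever
  the state. The bound on \<open>[i..n]\<close> is uniform in the state, so the letters in between
  do not spoil it.\<close>

lemma advances_unbounded: "\<exists>i\<le>n + 1. \<forall>T\<in>tails. D \<le> advances (map x [i..n]) T"
proof (induction D)
  case 0
  show ?case by auto
next
  case (Suc D)
  then obtain i where i: "i \<le> n + 1" "\<forall>T\<in>tails. D \<le> advances (map x [i..n]) T" by blast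
  obtain m where m: "- int m + int (length W) < i"
    "\<And>j. int j \<le> int m + n \<Longrightarrow> x (int j - int m) \<in> allowed W K j"
    using renewal_before[of i] by blast
  let ?V = "map x [int (length W) - int m..i - 1]"
  have "Suc D \<le> advances (map x [- int m..n]) T" if "T \<in> tails" for T
  proof -
    have W: "run W T \<in> tails"
    proof -
      have "map x [- int m..n] = W @ ?V @ map x [i..n]" by (rule map_upto_split) (use m i in auto)
      then have "\<forall>w\<in>set W. 1 \<le> w" using pos by (metis (no_types, lifting) UnCI ex_map_conv set_append)
      then show ?thesis using that by (rule run_tails[rotated])
    qed
    have "D \<le> advances (map x [i..n]) (run ?V (run W T))"
      using i(2) run_in_tails[OF W] by blast
    moreover have "1 \<le> advances W T" using advances[OF that] .
    moreover have "map x [- int m..n] = W @ ?V @ map x [i..n]" by (rule map_upto_split) (use m i in auto)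
    ultimately show ?thesis by (simp add: advances_append)
  qed
  moreover have "- int m \<le> n + 1" using m i by simp
  ultimately show ?case by blast
qed

text \<open>First \<open>i\<close> is chosen so that the front moves at least \<open>D\<close> times
  from then on, next a renewal whose word ends before \<open>i\<close>. After that word no
  information is lost, and the later displacements push the known region below bin
  \<open>- D\<close>.\<close>

lemma coupled_tails:
  "\<exists>i\<le>n + 1. \<exists>L. \<forall>T\<in>tails. \<forall>T'\<in>tails.
     agree L (run (map x [i..n]) T) (run (map x [i..n]) T') \<and>
     run (map x [i..n]) T (- int D) < enat L"
proof -
  obtain i where i: "i \<le> n + 1" "\<forall>T\<in>tails. D \<le> advances (map x [i..n]) T"
    using advances_unbounded by blast
  obtain m where m: "- int m + int (length W) < i"
    "\<And>j. int j \<le> int m + n \<Longrightarrow> x (int j - int m) \<in> allowed W K j"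
    using renewal_before[of i] by blast
  let ?V = "map x [int (length W) - int m..i - 1]"
  let ?R = "?V @ map x [i..n]"
  have split: "map x [- int m..n] = W @ ?R" by (rule map_upto_split) (use m i in auto)
  have R: "?R = map x [int (length W) - int m..n]"
    using upto_split2[of "int (length W) - int m" "i - 1" n] m i by simp
  have "\<forall>w\<in>set W. 1 \<le> w" using pos split by (metis (no_types, lifting) UnCI ex_map_conv set_append)
  then have W: "run W T \<in> tails" if "T \<in> tails" for T using that by (rule run_tails[rotated])
  have bound: "\<forall>j<length ?R. 1 \<le> ?R ! j \<and> ?R ! j \<le> K + j"
  proof (intro allI impI)
    fix j assume j: "j < length ?R"
    then have j': "int (length W) - int m + int j \<le> n" unfolding R by simp
    then have "?R ! j = x (int (length W + j) - int m)"
      unfolding R using j by (simp add: nth_upto R algebra_simps)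
    moreover have "x (int (length W + j) - int m) \<le> K + j"
      using m(2)[of "length W + j"] j' by (simp add: allowed_def)
    ultimately show "1 \<le> ?R ! j \<and> ?R ! j \<le> K + j" using pos by simp
  qed
  have "agree (K + length ?R) (run (map x [- int m..n]) T) (run (map x [- int m..n]) T') \<and>
      run (map x [- int m..n]) T (- int D) < enat (K + length ?R)"
    if T: "T \<in> tails" and T': "T' \<in> tails" for T T'
  proof -
    have "agree K (run W T) (run W T')"
      using coupling[OF T] coupling[OF T'] by (blast intro: agree_trans agree_sym)
    \<comment> \<open>After the word the front bin holds one ball, which is fewer than
      \<open>K\<close>, so the depth starts at 0.\<close>
    moreover have "run W T (- int 0) < enat K"
    proof -
      have "ideal a 0 0 < enat K" using K by (simp add: ideal_def)
      with agree_eq[OF agree_sym[OF coupling[OF T]]] show ?thesis by simp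
    qed
    ultimately have *: "agree (K + length ?R) (run ?R (run W T)) (run ?R (run W T')) \<and>
      run ?R (run W T) (- int (0 + advances ?R (run W T))) < enat (K + length ?R)"
      by (rule agree_run_advances[OF _ _ W[OF T] bound])
    have "D \<le> advances (map x [i..n]) (run ?V (run W T))"
      using i(2) run_in_tails[OF W[OF T]] by blast
    then have "D \<le> advances ?R (run W T)" by (simp add: advances_append)
    then have "run ?R (run W T) (- int D) \<le> run ?R (run W T) (- int (0 + advances ?R (run W T)))"
      unfolding R by (intro tails_antimono run_in_tails W T) simp
    with * show ?thesis unfolding split by (auto intro: le_less_trans)
  qed
  moreover have "- int m \<le> n + 1" using m i by simp
  ultimately show ?thesis by blast
qed

end

section \<open>Coalescence from the past\<close>

lemma fold_move_configs0:
  "X \<in> configs0 \<Longrightarrow> \<forall>w\<in>set ws. 1 \<le> w \<Longrightarrow> fold move ws X \<in> configs0"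
  by (induction ws arbitrary: X) (simp_all add: move_configs0)

lemma tail_fold_move:
  "X \<in> configs0 \<Longrightarrow> \<forall>w\<in>set ws. 1 \<le> w \<Longrightarrow> tail (fold move ws X) = run ws (tail X)"
  by (induction ws arbitrary: X) (simp_all add: move_configs0 tail_move)

lemma agree_imp_eq:
  assumes X: "X \<in> configs0" and X': "X' \<in> configs0"
    and A: "agree L (tail X) (tail X')" and D: "tail X (- D) < enat L" and k: "- D \<le> k"
  shows "X k = X' k"
proof -
  have lt: "tail X j < enat L" if "k \<le> j" for j
    using tails_antimono[OF tail_in_tails[OF X], of "- D" j] D k that by (auto intro: le_less_trans)
  have eq: "tail X' j = tail X j" if "k \<le> j" for j
    using agree_eq[OF A lt[OF that]] .
  have "X k + tail X (k + 1) = X' k + tail X (k + 1)"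
    using tail_rec[OF X, of k] tail_rec[OF X', of k] eq[of k] eq[of "k + 1"] by simp
  moreover have "tail X (k + 1) \<noteq> \<infinity>" using lt[of "k + 1"] by (cases "tail X (k + 1)") auto
  ultimately show ?thesis by (metis add.commute enat_add_left_cancel)
qed

text \<open>The starting time is chosen before the two configurations, so coalescence is uniform in
  the initial state.\<close>

definition coalescing :: "(int \<Rightarrow> nat) \<Rightarrow> bool" where
  "coalescing x \<longleftrightarrow> (\<forall>n D. \<exists>i\<le>n + 1. \<forall>X\<in>configs0. \<forall>X'\<in>configs0. \<forall>k\<ge>- int D.
     fold move (map x [i..n]) X k = fold move (map x [i..n]) X' k)"

lemma (in renewal) coupled_configs:
  "\<exists>i\<le>n + 1. \<forall>X\<in>configs0. \<forall>X'\<in>configs0. \<forall>k\<ge>- int D.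
     fold move (map x [i..n]) X k = fold move (map x [i..n]) X' k"
proof -
  obtain i L where i: "i \<le> n + 1"
    "\<forall>T\<in>tails. \<forall>T'\<in>tails. agree L (run (map x [i..n]) T) (run (map x [i..n]) T') \<and>
       run (map x [i..n]) T (- int D) < enat L"
    using coupled_tails[of D] by blast
  have pos': "\<forall>w\<in>set (map x [i..n]). 1 \<le> w" using pos by auto
  have "fold move (map x [i..n]) X k = fold move (map x [i..n]) X' k"
    if X: "X \<in> configs0" and X': "X' \<in> configs0" and k: "- int D \<le> k" for X X' k
    by (rule agree_imp_eq[where D = "int D" and L = L])
       (use i(2)[rule_format, OF tail_in_tails[OF X] tail_in_tails[OF X']] X X' k pos'
         in \<open>simp_all add: tail_fold_move fold_move_configs0\<close>)
  with i show ?thesis by blast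
qed

text \<open>Locality: a pinned configuration has more than \<open>D\<close> balls in the bins from
  \<open>- D\<close> to 0, so this window contains the \<xi>-th ball and decides the move. It lets
  the recursion pass to the limit in \<open>stationary_rec\<close>.\<close>

lemma move_cong:
  assumes X: "X \<in> configs0" and X': "X' \<in> configs0" and "1 \<le> \<xi>" "\<xi> \<le> D"
    and eq: "\<And>k. - int D \<le> k \<Longrightarrow> X k = X' k" and k: "- int D \<le> k"
  shows "move \<xi> X k = move \<xi> X' k"
proof -
  have tail_eq: "tail X k = tail X' k" if "- int D \<le> k" for k
  proof -
    have "tail X k = (\<Sum>j\<in>{k..0}. X j)" "tail X' k = (\<Sum>j\<in>{k..0}. X' j)"
      using X X' by (auto intro!: tail_eq_sum simp: configs0_iff)
    then show ?thesis using eq that by (auto intro!: sum.cong)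
  qed
  have ge: "- int D \<le> bin_pos Z \<xi>" if Z: "Z \<in> configs0" for Z
  proof -
    have "enat \<xi> \<le> enat (Suc D)" using assms by simp
    also have "\<dots> \<le> tail Z (- int D)" by (rule tails_ge[OF tail_in_tails[OF Z]])
    finally show ?thesis using le_bin_pos_iff[OF Z \<open>1 \<le> \<xi>\<close>] by simp
  qed
  have bin: "bin_pos X \<xi> = bin_pos X' \<xi>"
  proof (rule order_antisym)
    show "bin_pos X \<xi> \<le> bin_pos X' \<xi>"
      using le_bin_pos_iff[OF X \<open>1 \<le> \<xi>\<close>, of "bin_pos X \<xi>"] tail_eq[OF ge[OF X]]
      unfolding le_bin_pos_iff[OF X' \<open>1 \<le> \<xi>\<close>] by simp
    show "bin_pos X' \<xi> \<le> bin_pos X \<xi>"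
      using le_bin_pos_iff[OF X' \<open>1 \<le> \<xi>\<close>, of "bin_pos X' \<xi>"] tail_eq[OF ge[OF X']]
      unfolding le_bin_pos_iff[OF X \<open>1 \<le> \<xi>\<close>] by simp
  qed
  have "Phi \<xi> X j = Phi \<xi> X' j" if "- int D \<le> j" for j
    using eq[OF that] by (simp add: Phi_def bin)
  moreover have "front (Phi \<xi> X) = front (Phi \<xi> X')" "front (Phi \<xi> X') \<ge> 0"
    using tail_eq[of 0] by (simp_all add: front_Phi[OF X \<open>1 \<le> \<xi>\<close>] front_Phi[OF X' \<open>1 \<le> \<xi>\<close>])
  ultimately show ?thesis using k by (simp add: move_def Theta_def)
qed

section \<open>The stationary process as a limit from the past\<close>

definition full_config :: config where
  "full_config k = of_bool (k \<le> 0)"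

definition approx :: "(int \<Rightarrow> nat) \<Rightarrow> int \<Rightarrow> nat \<Rightarrow> config" where
  "approx x n m = fold move (map x [n - int m..n]) full_config"

text \<open>On a coalescing \<open>x\<close> the sequence is eventually constant in \<open>m\<close>; the lower limit is chosen so that
  the definition is measurable and pinned for every \<open>x\<close>.\<close>

definition stationary :: "(int \<Rightarrow> nat) \<Rightarrow> int \<Rightarrow> config" where
  "stationary x n k = liminf (\<lambda>m. approx x n m k)"

lemma approx_configs0: "(\<And>k. 1 \<le> x k) \<Longrightarrow> approx x n m \<in> configs0"
  unfolding approx_def
  by (intro fold_move_configs0) (auto simp: full_config_def configs0_iff)

lemma stationary_configs0:
  assumes "\<And>k. 1 \<le> x k"
  shows "stationary x n \<in> configs0"
  unfolding configs0_iff
proof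
  fix k :: int
  have *: "approx x n m k = 0 \<longleftrightarrow> k > 0" for m
    using approx_configs0[of x n m] assms by (simp add: configs0_iff)
  show "stationary x n k = 0 \<longleftrightarrow> k > 0"
  proof (cases "k > 0")
    case True
    then have "approx x n m k = 0" for m using * by blast
    then have "stationary x n k = liminf (\<lambda>m. 0 :: enat)" by (simp add: stationary_def)
    also have "\<dots> = 0" by (rule Liminf_const) simp
    finally show ?thesis using True by simp
  next
    case False
    then have "1 \<le> approx x n m k" for m
      using *[of m] by (simp add: ileI1 one_eSuc zero_less_iff_neq_zero)
    then have "1 \<le> stationary x n k"
      unfolding stationary_def by (intro Liminf_bounded) simp
    then show ?thesis using False by auto
  qed
qed

text \<open>A run started before \<open>i\<close> passes through some pinned configuration at
  \<open>i\<close>, after which the starting point is forgotten in the window. The first half serves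
  existence, the second uniqueness.\<close>

lemma stationary_eq_approx:
  assumes pos: "\<And>k. 1 \<le> x k" and "coalescing x"
  shows "\<exists>m. (\<forall>m'\<ge>m. \<forall>k\<ge>- int D. stationary x n k = approx x n m' k) \<and>
    (\<forall>X\<in>configs0. \<forall>i\<le>n - int m. \<forall>k\<ge>- int D. fold move (map x [i..n]) X k = stationary x n k)"
proof -
  obtain i where i: "i \<le> n + 1" and eq: "\<And>X X' k. X \<in> configs0 \<Longrightarrow> X' \<in> configs0 \<Longrightarrow> - int D \<le> k \<Longrightarrow>
     fold move (map x [i..n]) X k = fold move (map x [i..n]) X' k"
    using assms(2) unfolding coalescing_def by blast
  \<comment> \<open>Then \<open>n - m = i - 1\<close>, so every start considered lies strictly
    before \<open>i\<close>.\<close>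
  define m where "m = nat (n - i + 1)"
  have full: "full_config \<in> configs0" by (auto simp: full_config_def configs0_iff)
  have fold: "fold move (map x [j..n]) X k = fold move (map x [i..n]) full_config k"
    if "X \<in> configs0" "j \<le> n - int m" "- int D \<le> k" for X j k
  proof -
    have "[j..n] = [j..i - 1] @ [i..n]"
      using upto_split2[of j "i - 1" n] that i by (simp add: m_def)
    then have split: "fold move (map x [j..n]) X = fold move (map x [i..n]) (fold move (map x [j..i - 1]) X)"
      by simp
    have "fold move (map x [j..i - 1]) X \<in> configs0"
      using that pos by (intro fold_move_configs0) auto
    then show ?thesis unfolding split using full that(3) by (rule eq)
  qed
  have approx: "approx x n m' k = fold move (map x [i..n]) full_config k"
    if "m \<le> m'" "- int D \<le> k" for m' k
    unfolding approx_def by (rule fold) (use that full in simp_all)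
  have stat: "stationary x n k = fold move (map x [i..n]) full_config k" if "- int D \<le> k" for k
    unfolding stationary_def
  proof (rule lim_imp_Liminf)
    show "(\<lambda>m. approx x n m k) \<longlonglongrightarrow> fold move (map x [i..n]) full_config k"
      by (rule tendsto_eventually) (use approx that in \<open>auto simp: eventually_sequentially\<close>)
  qed simp
  show ?thesis
  proof (intro exI[of _ m] conjI allI ballI impI)
    show "stationary x n k = approx x n m' k" if "m \<le> m'" "- int D \<le> k" for m' k
      unfolding approx[OF that] stat[OF that(2)] ..
    show "fold move (map x [i..n]) X k = stationary x n k"
      if "X \<in> configs0" "i \<le> n - int m" "- int D \<le> k" for X i k
      unfolding fold[OF that] stat[OF that(3)] ..
  qed
qed

lemma stationary_rec:
  assumes pos: "\<And>k. 1 \<le> x k" and co: "coalescing x"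
  shows "stationary x (n + 1) = move (x (n + 1)) (stationary x n)"
proof
  fix k :: int
  \<comment> \<open>The window has to contain bin \<open>k\<close> and, for
    \<open>move_cong\<close>, be at least as deep as the type.\<close>
  define D where "D = max (nat (- k)) (x (n + 1))"
  have k: "- int D \<le> k" by (simp add: D_def)
  from stationary_eq_approx[of x D n, OF pos co] obtain m where
    m: "\<forall>m'\<ge>m. \<forall>k\<ge>- int D. stationary x n k = approx x n m' k" by meson
  from stationary_eq_approx[of x D "n + 1", OF pos co] obtain m1 where
    m1: "\<forall>m'\<ge>m1. \<forall>k\<ge>- int D. stationary x (n + 1) k = approx x (n + 1) m' k" by meson
  define m2 where "m2 = max m m1"
  have "stationary x (n + 1) k = approx x (n + 1) (Suc m2) k"
    using m1[rule_format, of "Suc m2" k] k by (simp add: m2_def)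
  \<comment> \<open>Both approximations start at time \<open>n - m2\<close>.\<close>
  also have "approx x (n + 1) (Suc m2) = move (x (n + 1)) (approx x n m2)"
    using upto_rec2[of "n - int m2" "n + 1"] by (simp add: approx_def)
  also have "\<dots> k = move (x (n + 1)) (stationary x n) k"
  proof (rule move_cong[where D = D])
    show "approx x n m2 k = stationary x n k" if "- int D \<le> k" for k
      using m[rule_format, of m2 k] that by (simp add: m2_def)
  qed (use pos k in \<open>auto simp: D_def approx_configs0 stationary_configs0\<close>)
  finally show "stationary x (n + 1) k = move (x (n + 1)) (stationary x n) k" .
qed

lemma stationary_unique:
  assumes pos: "\<And>k. 1 \<le> x k" and co: "coalescing x"
    and Y: "\<And>n. Y n \<in> configs0" "\<And>n. Y (n + 1) = move (x (n + 1)) (Y n)"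
  shows "Y n = stationary x n"
proof
  fix k :: int
  from stationary_eq_approx[of x "nat (- k)" n, OF pos co] obtain m where
    m: "\<forall>X\<in>configs0. \<forall>i\<le>n - int m. \<forall>k'\<ge>- int (nat (- k)). fold move (map x [i..n]) X k' = stationary x n k'"
    by meson
  have "Y (i + int j) = fold move (map x [i + 1..i + int j]) (Y i)" for i j
  proof (induction j)
    case (Suc j)
    have "Y (i + int (Suc j)) = move (x (i + int j + 1)) (Y (i + int j))"
      using Y(2)[of "i + int j"] by (simp add: algebra_simps)
    then show ?case using upto_rec2[of "i + 1" "i + int (Suc j)"] Suc by (simp add: algebra_simps)
  qed simp
  \<comment> \<open>The state at time \<open>n - m - 1\<close> is first acted on by the type at
    \<open>n - m\<close>, which gives \<open>m + 1\<close> moves.\<close>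
  from this[of "n - int m - 1" "Suc m"]
  have "Y n = fold move (map x [n - int m..n]) (Y (n - int m - 1))" by simp
  then show "Y n k = stationary x n k" using m[rule_format, OF Y(1), of "n - int m" k] by simp
qed

text \<open>Moving the end time adds at most finitely many constraints. Their types are bounded by
  \<open>B\<close>, and for large \<open>m\<close> they come so late after the word that every type
  up to \<open>B\<close> is allowed.\<close>

lemma often_shift:
  fixes x :: "int \<Rightarrow> nat"
  assumes often: "\<And>N. \<exists>m\<ge>N. \<forall>j. int j \<le> int m + n \<longrightarrow> x (int j - int m) \<in> allowed W K j"
  shows "\<exists>m\<ge>N. \<forall>j. int j \<le> int m + n' \<longrightarrow> x (int j - int m) \<in> allowed W K j"
proof -
  define B where "B = (\<Sum>k\<in>{n..n'}. x k)"
  have B: "x k \<le> B" if "n \<le> k" "k \<le> n'" for k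
    unfolding B_def using that by (intro member_le_sum) auto
  obtain m where m: "m \<ge> max N (length W + B + nat \<bar>n\<bar>)"
    "\<And>j. int j \<le> int m + n \<Longrightarrow> x (int j - int m) \<in> allowed W K j"
    using often by meson
  have "x (int j - int m) \<in> allowed W K j" if j: "int j \<le> int m + n'" for j
  proof (cases "int j \<le> int m + n")
    case False
    then have "length W + B \<le> j" using m(1) by linarith
    moreover have "x (int j - int m) \<le> B" using False j by (intro B) auto
    ultimately show ?thesis by (auto simp: allowed_def)
  qed (use m in auto)
  with m(1) show ?thesis by (intro exI[of _ m]) auto
qed

section \<open>Renewals occur infinitely often\<close>

lemma measurable_map_list:
  assumes "\<And>k. k \<in> set ks \<Longrightarrow> f k \<in> measurable M (count_space UNIV)"
  shows "(\<lambda>\<omega>. map (\<lambda>k. f k \<omega> :: nat) ks) \<in> measurable M (count_space UNIV)"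
  using assms
proof (induction ks)
  case (Cons k ks)
  note [measurable] = Cons.prems[of k]
  have [measurable]: "(\<lambda>\<omega>. map (\<lambda>k. f k \<omega>) ks) \<in> measurable M (count_space UNIV)"
    using Cons by simp
  have "(\<lambda>(w, ws). w # ws) \<in> measurable (count_space UNIV \<Otimes>\<^sub>M count_space UNIV) (count_space (UNIV :: nat list set))"
    by (simp add: pair_measure_countable)
  then have "(\<lambda>\<omega>. (\<lambda>(w, ws). w # ws) (f k \<omega>, map (\<lambda>k. f k \<omega>) ks)) \<in> measurable M (count_space UNIV)"
    by (rule measurable_compose[rotated]) measurable
  then show ?case by simp
qed simp

lemma measurable_past: "k \<le> n \<Longrightarrow> \<xi> k \<in> measurable (past M \<xi> n) (count_space UNIV)"
  unfolding past_def by (rule measurableI) (auto simp: space_measure_of_conv)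

lemma space_past: "space (past M \<xi> n) = space M"
  by (simp add: past_def space_measure_of_conv)

lemma stationary_measurable:
  fixes \<xi> :: "int \<Rightarrow> 'a \<Rightarrow> nat"
  assumes pos: "\<And>n \<omega>. \<omega> \<in> space M \<Longrightarrow> 1 \<le> \<xi> n \<omega>"
  shows "(\<lambda>\<omega>. stationary (\<lambda>k. \<xi> k \<omega>) n) \<in> measurable (past M \<xi> n) config0_space"
  unfolding config0_space_def
proof (rule measurable_restrict_space2)
  show "(\<lambda>\<omega>. stationary (\<lambda>k. \<xi> k \<omega>) n) \<in> space (past M \<xi> n) \<rightarrow> configs0"
    using pos by (auto simp: space_past intro!: stationary_configs0)
  show "(\<lambda>\<omega>. stationary (\<lambda>k. \<xi> k \<omega>) n) \<in> measurable (past M \<xi> n) (\<Pi>\<^sub>M k\<in>UNIV. count_space UNIV)"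
  proof (rule measurable_PiM_single')
    fix k :: int
    have [measurable]: "(\<lambda>\<omega>. approx (\<lambda>k. \<xi> k \<omega>) n m k) \<in> measurable (past M \<xi> n) (count_space UNIV)" for m
    proof -
      \<comment> \<open>The approximation depends on a finite list of types, and on the discrete
        space of lists every map is measurable.\<close>
      have "(\<lambda>\<omega>. map (\<lambda>k. \<xi> k \<omega>) [n - int m..n]) \<in> measurable (past M \<xi> n) (count_space UNIV)"
        by (intro measurable_map_list measurable_past) auto
      then show ?thesis
        unfolding approx_def by (rule measurable_compose) simp
    qed
    show "(\<lambda>\<omega>. stationary (\<lambda>k. \<xi> k \<omega>) n k) \<in> measurable (past M \<xi> n) (count_space UNIV)"
      unfolding stationary_def liminf_SUP_INF by measurable
  qed simp
qed

text \<open>Weierstrass product inequality; for independent events it is the union bound on the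
  complements.\<close>

lemma one_minus_sum_le_prod:
  fixes p :: "'b \<Rightarrow> real"
  assumes "finite A" "\<And>i. i \<in> A \<Longrightarrow> 0 \<le> p i \<and> p i \<le> 1"
  shows "1 - (\<Sum>i\<in>A. 1 - p i) \<le> (\<Prod>i\<in>A. p i)"
  using assms
proof (induction A)
  case (insert a A)
  have "(\<Prod>i\<in>A. p i) * (1 - p a) \<le> 1 * (1 - p a)"
    using insert.prems by (intro mult_right_mono prod_le_1) auto
  moreover have "1 - (\<Sum>i\<in>A. 1 - p i) \<le> (\<Prod>i\<in>A. p i)"
    using insert by simp
  ultimately show ?case using insert by (simp add: algebra_simps)
qed simp

text \<open>The mean is the sum over \<open>t\<close> of the probabilities that the type exceeds
  \<open>t\<close>.\<close>

lemma summable_tail_prob: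
  fixes \<mu> :: "nat pmf"
  assumes "(\<lambda>k. real k * pmf \<mu> k) summable_on {1..}"
  shows "summable (\<lambda>t. measure_pmf.prob \<mu> {t<..})"
proof (rule summable_suminf_not_top)
  have "(\<lambda>k. real k * pmf \<mu> k) summable_on UNIV \<longleftrightarrow> (\<lambda>k. real k * pmf \<mu> k) summable_on {1..}"
    by (rule summable_on_cong_neutral) auto
  then have s: "summable (\<lambda>k. real k * pmf \<mu> k)"
    using assms by (intro summable_on_imp_summable) simp
  have "(\<Sum>t. ennreal (measure_pmf.prob \<mu> {t<..})) =
      (\<Sum>t. emeasure (measure_pmf \<mu>) {x \<in> space (measure_pmf \<mu>). enat t < enat x})"
    by (simp add: measure_pmf.emeasure_eq_measure greaterThan_def)
  also have "\<dots> = (\<integral>\<^sup>+ x. ennreal_of_enat (enat x) \<partial>measure_pmf \<mu>)"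
    by (rule nn_integral_enat_function[symmetric]) simp
  also have "\<dots> = (\<Sum>k. ennreal (real k * pmf \<mu> k))"
    by (simp add: nn_integral_measure_pmf nn_integral_count_space_nat ennreal_of_nat_eq_real_of_nat
        ennreal_mult mult.commute)
  also have "\<dots> = ennreal (\<Sum>k. real k * pmf \<mu> k)"
    by (rule suminf_ennreal2) (use s in auto)
  finally show "(\<Sum>t. ennreal (measure_pmf.prob \<mu> {t<..})) \<noteq> top" by simp
qed simp

text \<open>\<open>K\<close> is fixed before \<open>W\<close> because the coupling word depends on
  \<open>K\<close>. The tail sum from \<open>K\<close> on is at most 1/2, so the letters after
  \<open>W\<close> keep a product of at least 1/2; the letters of \<open>W\<close> cost a positive
  factor.\<close>

lemma prod_allowed_bound:
  fixes \<mu> :: "nat pmf"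
  assumes sum: "summable (\<lambda>t. measure_pmf.prob \<mu> {t<..})"
  shows "\<exists>K\<ge>2. \<forall>W. set W \<subseteq> set_pmf \<mu> \<longrightarrow>
    (\<exists>\<delta>>0. \<forall>m. \<delta> \<le> (\<Prod>j\<le>m. measure_pmf.prob \<mu> (allowed W K j)))"
proof -
  let ?q = "\<lambda>t. measure_pmf.prob \<mu> {t<..}"
  from sum obtain N where N: "\<forall>m\<ge>N. \<forall>n. norm (sum ?q {m..<n}) < 1/2"
    unfolding summable_Cauchy by (meson half_gt_zero zero_less_one)
  define K where "K = max N 2"
  have K: "sum ?q {K..<n} \<le> 1/2" for n
    using N[rule_format, of K n] by (auto simp: K_def sum_nonneg)
  have "\<exists>\<delta>>0. \<forall>m. \<delta> \<le> (\<Prod>j\<le>m. measure_pmf.prob \<mu> (allowed W K j))"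
    if W: "set W \<subseteq> set_pmf \<mu>" for W
  proof -
    let ?p = "\<lambda>j. measure_pmf.prob \<mu> (allowed W K j)"
    let ?l = "length W"
    have word: "0 < ?p j" if "j < ?l" for j
    proof -
      have "W ! j \<in> set_pmf \<mu>" using W that by auto
      then show ?thesis using that
        by (simp add: allowed_def measure_pmf_single pmf_positive)
    qed
    have compl: "1 - ?p (?l + i) = ?q (K + i)" for i
    proof -
      have "{K + i<..} = UNIV - {..K + i}" by auto
      then show ?thesis
        using measure_pmf.prob_compl[of "{..K + i}" \<mu>] by (simp add: allowed_def)
    qed
    have head: "(\<Prod>j<?l. ?p j) > 0" using word by (intro prod_pos) auto
    have rest: "1/2 \<le> (\<Prod>i<n. ?p (?l + i))" for n
    proof -
      have "(\<Sum>i<n. 1 - ?p (?l + i)) = (\<Sum>i<n. ?q (K + i))" by (simp add: compl)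
      also have "\<dots> = sum ?q {K..<K + n}"
        using sum.shift_bounds_nat_ivl[of ?q 0 K n] by (simp add: atLeast0LessThan add.commute)
      finally have "(\<Sum>i<n. 1 - ?p (?l + i)) \<le> 1/2" using K by simp
      then show ?thesis
        using one_minus_sum_le_prod[of "{..<n}" "\<lambda>i. ?p (?l + i)"] by simp
    qed
    have split: "(\<Prod>j<?l. ?p j) * (\<Prod>i<n. ?p (?l + i)) = (\<Prod>j<?l + n. ?p j)" for n
      by (induction n) (simp_all add: mult.assoc[symmetric])
    have "(\<Prod>j<?l. ?p j) * (1/2) \<le> (\<Prod>j\<le>m. ?p j)" for m
    proof -
      have "(\<Prod>j<?l. ?p j) * (1/2) \<le> (\<Prod>j<?l. ?p j) * (\<Prod>i<Suc m. ?p (?l + i))"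
        by (rule mult_left_mono[OF rest less_imp_le[OF head]])
      also have "\<dots> = (\<Prod>j<?l + Suc m. ?p j)"
        by (rule split)
      \<comment> \<open>The extra factors are at most 1; this also covers \<open>m\<close> below the
        length of \<open>W\<close>.\<close>
      also have "\<dots> \<le> (\<Prod>j\<le>m. ?p j)"
      proof -
        have "(\<Prod>j<?l + Suc m. ?p j) = (\<Prod>j\<in>{..<?l + Suc m} - {..m}. ?p j) * (\<Prod>j\<le>m. ?p j)"
          by (rule prod.subset_diff) auto
        also have "\<dots> \<le> 1 * (\<Prod>j\<le>m. ?p j)"
          by (intro mult_right_mono prod_le_1 prod_nonneg) auto
        finally show ?thesis by simp
      qed
      finally show ?thesis .
    qed
    then show ?thesis using head by (intro exI[of _ "(\<Prod>j<?l. ?p j) * (1/2)"]) auto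
  qed
  then show ?thesis by (intro exI[of _ K]) (simp add: K_def)
qed


text \<open>By \<open>often_shift\<close> any finite number of the most recent constraints can be dropped.\<close>

lemma (in prob_space) often_tail_event:
  fixes \<xi> :: "int \<Rightarrow> 'a \<Rightarrow> nat"
  assumes rv: "\<And>k. random_variable (count_space UNIV) (\<xi> k)"
  shows "{\<omega> \<in> space M. \<forall>N. \<exists>m\<ge>N. \<forall>j. int j \<le> int m \<longrightarrow> \<xi> (int j - int m) \<omega> \<in> allowed W K j}
    \<in> tail_events (\<lambda>i. sigma_sets (space M) {\<xi> (- int i) -` B \<inter> space M | B. B \<in> UNIV})"
    (is "?L \<in> tail_events ?A")
  unfolding tail_events_def
proof (intro INT_I)
  fix r :: nat
  define G where "G = \<Union> (?A ` {r..})"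
  have Gsub: "G \<subseteq> Pow (space M)"
    unfolding G_def by (auto dest: sigma_sets_into_sp[rotated])
  define R where "R = sigma (space M) G"
  have space_R: "space R = space M" by (simp add: R_def space_measure_of_conv)
  have sets_R: "sets R = sigma_sets (space M) G" using Gsub by (simp add: R_def)
  have meas: "\<xi> (- int i) \<in> measurable R (count_space UNIV)" if "r \<le> i" for i
  proof (rule measurableI)
    fix B :: "nat set"
    have "\<xi> (- int i) -` B \<inter> space M \<in> ?A i" by (rule sigma_sets.Basic) auto
    then have "\<xi> (- int i) -` B \<inter> space M \<in> G" unfolding G_def using that by blast
    then show "\<xi> (- int i) -` B \<inter> space R \<in> sets R" unfolding sets_R space_R by (rule sigma_sets.Basic)
  qed simp
  \<comment> \<open>The truncated constraint reads \<open>\<xi>\<close> only at times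
    \<open>- i\<close> with \<open>i \<ge> r\<close>; time is reversed so that the tail lies in the
    far past.\<close>
  have [measurable]: "Measurable.pred R (\<lambda>\<omega>. int j \<le> int m + (- int r) \<longrightarrow> \<xi> (int j - int m) \<omega> \<in> allowed W K j)"
    for j m
  proof (cases "int j \<le> int m + (- int r)")
    case True
    then have eq: "int j - int m = - int (m - j)" by simp
    have [measurable]: "\<xi> (int j - int m) \<in> measurable R (count_space UNIV)"
      unfolding eq by (rule meas) (use True in auto)
    show ?thesis by measurable
  qed simp
  have "?L = {\<omega> \<in> space R. \<forall>N. \<exists>m\<ge>N. \<forall>j. int j \<le> int m + (- int r) \<longrightarrow> \<xi> (int j - int m) \<omega> \<in> allowed W K j}"
    unfolding space_R
  proof (intro Collect_cong conj_cong refl iffI allI)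
    fix \<omega> N
    assume "\<forall>N. \<exists>m\<ge>N. \<forall>j. int j \<le> int m \<longrightarrow> \<xi> (int j - int m) \<omega> \<in> allowed W K j"
    then show "\<exists>m\<ge>N. \<forall>j. int j \<le> int m + (- int r) \<longrightarrow> \<xi> (int j - int m) \<omega> \<in> allowed W K j"
      using often_shift[of 0 "\<lambda>k. \<xi> k \<omega>" W K N "- int r"] by simp
  next
    fix \<omega> N
    assume "\<forall>N. \<exists>m\<ge>N. \<forall>j. int j \<le> int m + (- int r) \<longrightarrow> \<xi> (int j - int m) \<omega> \<in> allowed W K j"
    then show "\<exists>m\<ge>N. \<forall>j. int j \<le> int m \<longrightarrow> \<xi> (int j - int m) \<omega> \<in> allowed W K j"
      using often_shift[of "- int r" "\<lambda>k. \<xi> k \<omega>" W K N 0] by simp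
  qed
  also have "\<dots> \<in> sets R" by measurable
  finally show "?L \<in> sigma_sets (space M) (\<Union> (?A ` {r..}))" unfolding sets_R G_def .
qed

text \<open>A renewal at time \<open>- m\<close> has probability at least \<delta> for every
  \<open>m\<close>, so by continuity from above infinitely many occur with probability at least
  \<delta>. These events share coordinates; the zero-one law lifts the probability to 1.\<close>

lemma (in prob_space) AE_often:
  fixes \<xi> :: "int \<Rightarrow> 'a \<Rightarrow> nat" and \<mu> :: "nat pmf"
  assumes indep: "indep_vars (\<lambda>_. count_space UNIV) \<xi> UNIV"
    and law: "\<And>n. distr M (count_space UNIV) (\<xi> n) = measure_pmf \<mu>"
    and "\<delta> > 0" and \<delta>: "\<And>m. \<delta> \<le> (\<Prod>j\<le>m. measure_pmf.prob \<mu> (allowed W K j))"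
  shows "AE \<omega> in M. \<forall>N. \<exists>m\<ge>N. \<forall>j. int j \<le> int m \<longrightarrow> \<xi> (int j - int m) \<omega> \<in> allowed W K j"
proof -
  have rv [measurable]: "random_variable (count_space UNIV) (\<xi> k)" for k
    using indep by (auto simp: indep_vars_def2)
  define G where "G m = {\<omega> \<in> space M. \<forall>j. int j \<le> int m \<longrightarrow> \<xi> (int j - int m) \<omega> \<in> allowed W K j}" for m
  define L where "L = {\<omega> \<in> space M. \<forall>N. \<exists>m\<ge>N. \<forall>j. int j \<le> int m \<longrightarrow> \<xi> (int j - int m) \<omega> \<in> allowed W K j}"
  have G_sets [measurable]: "G m \<in> events" for m unfolding G_def by measurable
  have prob_eq: "prob (\<xi> i -` B \<inter> space M) = measure_pmf.prob \<mu> B" for i B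
    using measure_distr[OF rv[of i], of B] law[of i] by simp
  have prob_G: "prob (G m) = (\<Prod>j\<le>m. measure_pmf.prob \<mu> (allowed W K j))" for m
  proof -
    let ?I = "(\<lambda>j. int j - int m) ` {..m}"
    have "G m = (\<Inter>i\<in>?I. \<xi> i -` allowed W K (nat (i + int m)) \<inter> space M)"
      by (auto simp: G_def)
    also have "prob \<dots> = (\<Prod>i\<in>?I. prob (\<xi> i -` allowed W K (nat (i + int m)) \<inter> space M))"
      by (rule indep_varsD[OF indep]) auto
    also have "\<dots> = (\<Prod>i\<in>?I. measure_pmf.prob \<mu> (allowed W K (nat (i + int m))))"
      by (simp add: prob_eq)
    also have "\<dots> = (\<Prod>j\<le>m. measure_pmf.prob \<mu> (allowed W K j))"
      by (subst prod.reindex) (auto simp: inj_on_def)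
    finally show ?thesis .
  qed
  have L: "L = (\<Inter>N. \<Union>m\<in>{N..}. G m)" by (auto simp: L_def G_def)
  have "(\<lambda>N. prob (\<Union>m\<in>{N..}. G m)) \<longlonglongrightarrow> prob L"
    unfolding L by (rule finite_Lim_measure_decseq) (fastforce simp: decseq_def)+
  moreover have "\<delta> \<le> prob (\<Union>m\<in>{N..}. G m)" for N
  proof -
    have "\<delta> \<le> prob (G N)" using \<delta> prob_G by simp
    also have "\<dots> \<le> prob (\<Union>m\<in>{N..}. G m)" by (rule finite_measure_mono) auto
    finally show ?thesis .
  qed
  ultimately have "\<delta> \<le> prob L" by (intro LIMSEQ_le_const) auto
  moreover have "prob L = 0 \<or> prob L = 1"
  proof (rule kolmogorov_0_1_law)
    let ?A = "\<lambda>i. sigma_sets (space M) {\<xi> (- int i) -` B \<inter> space M | B. B \<in> UNIV}"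
    show "sigma_algebra (space M) (?A i)" for i
      by (rule sigma_algebra_sigma_sets) auto
    show "L \<in> tail_events ?A"
      unfolding L_def by (rule often_tail_event[OF rv])
    \<comment> \<open>Independence is transported along the injection sending \<open>i\<close> to
      \<open>- i\<close>.\<close>
    have *: "indep_sets (\<lambda>k. sigma_sets (space M) {\<xi> k -` B \<inter> space M | B. B \<in> UNIV}) UNIV"
      using indep by (simp add: indep_vars_def)
    show "indep_sets ?A UNIV"
    proof (rule indep_setsI)
      show "?A i \<subseteq> events" for i
        using * by (simp add: indep_sets_def)
      fix A and J :: "nat set"
      assume J: "J \<noteq> {}" "J \<subseteq> UNIV" "finite J" and A: "\<forall>j\<in>J. A j \<in> ?A j"
      let ?J = "(\<lambda>j. - int j) ` J"
      have "prob (\<Inter>k\<in>?J. A (nat (- k))) = (\<Prod>k\<in>?J. prob (A (nat (- k))))"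
        by (rule indep_setsD[OF *]) (use J A in auto)
      then show "prob (\<Inter>j\<in>J. A j) = (\<Prod>j\<in>J. prob (A j))"
        by (simp add: prod.reindex inj_on_def)
    qed
  qed
  ultimately have "prob L = 1" using \<open>\<delta> > 0\<close> by auto
  then have "AE \<omega> in M. \<omega> \<in> L" by (simp add: prob_eq_1 L)
  then show ?thesis by eventually_elim (simp add: L_def)
qed

lemma two_atoms:
  fixes \<mu> :: "nat pmf"
  assumes "set_pmf \<mu> \<subseteq> {1..}" "(SUP k\<in>{1..}. pmf \<mu> k) < 1"
  obtains a b where "a \<in> set_pmf \<mu>" "b \<in> set_pmf \<mu>" "a < b"
proof -
  obtain a where a: "a \<in> set_pmf \<mu>" using set_pmf_not_empty[of \<mu>] by blast
  have "set_pmf \<mu> \<noteq> {a}"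
  proof
    assume "set_pmf \<mu> = {a}"
    then have "\<mu> = return_pmf a" using set_pmf_subset_singleton[of \<mu> a] by simp
    then have "pmf \<mu> a = 1" by simp
    moreover have "pmf \<mu> a \<le> (SUP k\<in>{1..}. pmf \<mu> k)"
      by (rule cSUP_upper) (use a assms(1) in \<open>auto intro!: bdd_aboveI2[of _ _ 1] pmf_le_1\<close>)
    ultimately show False using assms(2) by simp
  qed
  then obtain b where "b \<in> set_pmf \<mu>" "b \<noteq> a" using a by auto
  with a show thesis using that[of a b] that[of b a] by (cases "a < b") auto
qed

text \<open>The choices are ordered: \<open>K\<close> from the tail of the law, \<open>W\<close>
  from \<open>K\<close>, then \<delta> from \<open>W\<close>. A single null set serves all
  \<open>n\<close> and \<open>D\<close>, as \<open>often_shift\<close> is pathwise.\<close>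

lemma (in prob_space) AE_coalescing:
  fixes \<xi> :: "int \<Rightarrow> 'a \<Rightarrow> nat" and \<mu> :: "nat pmf"
  assumes \<mu>: "set_pmf \<mu> \<subseteq> {1..}" "(\<lambda>k. real k * pmf \<mu> k) summable_on {1..}"
      "(SUP k\<in>{1..}. pmf \<mu> k) < 1"
    and pos: "\<And>n \<omega>. \<omega> \<in> space M \<Longrightarrow> 1 \<le> \<xi> n \<omega>"
    and indep: "indep_vars (\<lambda>_. count_space UNIV) \<xi> UNIV"
    and law: "\<And>n. distr M (count_space UNIV) (\<xi> n) = measure_pmf \<mu>"
  shows "AE \<omega> in M. coalescing (\<lambda>k. \<xi> k \<omega>)"
proof -
  obtain a b where ab: "a \<in> set_pmf \<mu>" "b \<in> set_pmf \<mu>" "a < b"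
    using two_atoms[OF \<mu>(1,3)] .
  then have "1 \<le> a" using \<mu>(1) by auto
  from prod_allowed_bound[OF summable_tail_prob[OF \<mu>(2)]] obtain K where K: "2 \<le> K"
      "\<forall>W. set W \<subseteq> set_pmf \<mu> \<longrightarrow>
         (\<exists>\<delta>>0. \<forall>m. \<delta> \<le> (\<Prod>j\<le>m. measure_pmf.prob \<mu> (allowed W K j)))"
    by meson
  obtain W where W: "set W \<subseteq> {a, b}"
      "\<And>T. T \<in> tails \<Longrightarrow> agree K (run W T) (ideal a 0) \<and> 1 \<le> advances W T"
    using coupling_word[OF \<open>1 \<le> a\<close> \<open>a < b\<close>, of K] by blast
  obtain \<delta> where "\<delta> > 0" "\<And>m. \<delta> \<le> (\<Prod>j\<le>m. measure_pmf.prob \<mu> (allowed W K j))"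
    using K(2)[rule_format, of W] W(1) ab by auto
  from AE_often[OF indep law this] AE_space show ?thesis
  proof eventually_elim
    case (elim \<omega>)
    show ?case unfolding coalescing_def
    proof (intro allI)
      fix n D
      interpret renewal W K a "\<lambda>k. \<xi> k \<omega>" n
      proof
        show "\<exists>m\<ge>N. \<forall>j. int j \<le> int m + n \<longrightarrow> \<xi> (int j - int m) \<omega> \<in> allowed W K j" for N
          using often_shift[of 0 "\<lambda>k. \<xi> k \<omega>" W K N n] elim(1) by simp
      qed (use K(1) W(2) pos elim in auto)
      show "\<exists>i\<le>n + 1. \<forall>X\<in>configs0. \<forall>X'\<in>configs0. \<forall>k\<ge>- int D.
          fold move (map (\<lambda>k. \<xi> k \<omega>) [i..n]) X k = fold move (map (\<lambda>k. \<xi> k \<omega>) [i..n]) X' k"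
        by (rule coupled_configs)
    qed
  qed
qed

theorem theorem3p23:
  fixes M :: "'a measure" and \<mu> :: "nat pmf" and \<xi> :: "int \<Rightarrow> 'a \<Rightarrow> nat"
  assumes "prob_space M"
    and "set_pmf \<mu> \<subseteq> {1..}"
    and "(\<lambda>k. real k * pmf \<mu> k) summable_on {1..}"
    and "(SUP k\<in>{1..}. pmf \<mu> k) < 1"
    and "\<And>n \<omega>. \<omega> \<in> space M \<Longrightarrow> \<xi> n \<omega> \<ge> 1"
    and "prob_space.indep_vars M (\<lambda>_. count_space UNIV) \<xi> UNIV"
    and "\<And>n. distr M (count_space UNIV) (\<xi> n) = measure_pmf \<mu>"
  shows "\<exists>Y. adapted_solution M \<xi> Y \<and>
           (\<forall>Y'. adapted_solution M \<xi> Y' \<longrightarrow> (AE \<omega> in M. \<forall>n. Y' n \<omega> = Y n \<omega>))"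
proof -
  note pos = assms(5)
  have coalescing: "AE \<omega> in M. coalescing (\<lambda>k. \<xi> k \<omega>)"
    by (rule prob_space.AE_coalescing[OF assms])
  define Y where "Y n \<omega> = stationary (\<lambda>k. \<xi> k \<omega>) n" for n \<omega>
  have "adapted_solution M \<xi> Y"
    unfolding adapted_solution_def
  proof (intro conjI allI)
    show "Y n \<in> measurable (past M \<xi> n) config0_space" for n
      unfolding Y_def using pos by (rule stationary_measurable)
    show "AE \<omega> in M. \<forall>n. Y (n + 1) \<omega> = Theta (Phi (\<xi> (n + 1) \<omega>) (Y n \<omega>))"
      using coalescing AE_space
    proof eventually_elim
      case (elim \<omega>)
      then show ?case
        using stationary_rec[of "\<lambda>k. \<xi> k \<omega>"] pos by (simp add: Y_def move_def)
    qed
  qed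
  moreover have "AE \<omega> in M. \<forall>n. Y' n \<omega> = Y n \<omega>" if Y': "adapted_solution M \<xi> Y'" for Y'
  proof -
    \<comment> \<open>Membership holds at every point, as it comes from the target space of the
      measurable map.\<close>
    have configs0: "Y' n \<omega> \<in> configs0" if "\<omega> \<in> space M" for n \<omega>
      using measurable_space[of "Y' n" "past M \<xi> n" config0_space \<omega>] Y' that
      by (auto simp: adapted_solution_def space_past config0_space_def space_restrict_space)
    from Y' have "AE \<omega> in M. \<forall>n. Y' (n + 1) \<omega> = Theta (Phi (\<xi> (n + 1) \<omega>) (Y' n \<omega>))"
      by (simp add: adapted_solution_def)
    with coalescing AE_space show ?thesis
    proof eventually_elim
      case (elim \<omega>)
      then show ?case
        using stationary_unique[of "\<lambda>k. \<xi> k \<omega>" "\<lambda>n. Y' n \<omega>"] pos configs0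
        by (simp add: Y_def move_def)
    qed
  qed
  ultimately show ?thesis by blast
qed

end
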